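(* Let $(\mathcal W,\phi,\phi^+,\delta,F)$ be either $(W,\Phi,\Phi^+,\Delta,\mathcal C)$ (finite case) or $(W_a,\Phi_a,\Phi_a^+,\Delta_a,\mathcal A)$ (affine case). Suppose that $I\subset\phi^+$ is consistent, that $X$ is a reflectable process in $V$, and that $x\in F$. Then for every $t\ge0$ $$\mathbb{P}_x(T_\delta>t)=\sum_{A\in\mathcal I}\varepsilon_A\,\mathbb{P}_x(T_A>t).$$
   Context: Root systems. $V$ is a finite-dimensional real Euclidean space with inner product $\langle\cdot,\cdot\rangle$; $\Phi$ is an irreducible crystallographic root system in $V$ with Weyl group $W$, simple system $\Delta$, corresponding positive system $\Phi^+$, highest positive root $\widetilde\alpha$, and fundamental chamber $\mathcal C=\{x\in V:\langle\alpha,x\rangle>0\ \forall\alpha\in\Delta\}$. Put $\alpha^\vee=2\alpha/\langle\alpha,\alpha\rangle$, $s_\alpha(x)=x-\langle\alpha,x\rangle\alpha^\vee$, and let $L$ be the $\mathbb{Z}$-span of the coroots $\alpha^\vee$. The affine Weyl group $W_a$ is generated by the reflections in the hyperplanes $\{x:\langle x,\alpha\rangle=n\}$, $\alpha\in\Phi^+,n\in\mathbb{Z}$; each element is uniquely $w_a=\tau(l)w$ with $w\in W$ and $\tau(l)$ translation by $l\in L$. The sign is $\varepsilon(\tau(l)w)=\varepsilon(w)=\det w$. Affine roots. $\Phi_a=\Phi\times\mathbb{Z}$; for $\lambda=(\alpha,n)\in\Phi_a$, $\lambda.x=\lambda(x)=\langle\alpha,x\rangle-n$. $W_a$ acts on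 $\Phi_a$ by $\tau(l)w\,(\alpha,n)=(w\alpha,\,n+\langle w\alpha,l\rangle)$. $\Delta_a=\{(\alpha,0):\alpha\in\Delta\}\cup\{(-\widetilde\alpha,-1)\}$, $\Phi_a^+=\{(\alpha,n): (n=0\text{ and }\alpha\in\Phi^+)\text{ or }n\le -1\}$, and $\mathcal A=\{x\in V:\lambda(x)>0\ \forall\lambda\in\Delta_a\}$ is the fundamental alcove. In the finite case $\alpha\in\Phi$ is identified with $(\alpha,0)$. Two roots $(\alpha,m),(\beta,n)$ are orthogonal if $\langle\alpha,\beta\rangle=0$. Consistency. For $I\subset\phi^+$ let $\mathcal W^I=\{w\in\mathcal W:wI\subset\phi^+\}$ and $\mathcal I=\{wI:w\in\mathcal W^I\}$. $I$ is consistent if: (C1) there is a subset $J\subset\delta\cap I$ of pairwise orthogonal roots such that $J\subset A\in\mathcal I$ implies $A=I$; (C2) $\varepsilon(w)=1$ for every $w\in\mathcal W$ with $wI=I$; (C3) $\mathcal I$ is finite. By (C2), for $A\in\mathcal I$ the sign $\varepsilon_A:=\varepsilon(w)$, where $w\in\mathcal W^I$ is any element with $wI=A$, is well defined. Processes. $X=(X_t)_{t\ge0}$ is a $V$-valued process, with law $\mathbb{P}_x$ when started at $x$. It is reflectable if it has the strong Markov property, has almost surely continuous sample paths, and its law is $\mathcal W$-invariant: $\mathbb{P}_x\circ(wX)^{-1}=\mathbb{P}_{wx}\circ X^{-1}$ for all $w\in\mathcal W$, $x\in V$. For $\lambda\in\phi^+$, $T_\lambda=\inf\{t\ge0:\lambda.X_t=0\}$,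 and for $A\subset\phi^+$, $T_A=\min_{\lambda\in A}T_\lambda$. Thus $T_\delta$ is the first exit time from $F$. *)

theory Defs
  imports "HOL-Probability.Probability"
begin

section \<open>Root systems and Weyl groups\<close>

definition coroot :: "real^'n \<Rightarrow> real^'n" where
  "coroot \<alpha> = (2 / (\<alpha> \<bullet> \<alpha>)) *\<^sub>R \<alpha>"

text \<open>Reflection in the hyperplane of all \<open>x\<close> with \<open>\<alpha> \<bullet> x = n\<close>; \<open>reflection \<alpha> 0\<close> is \<open>s\<^sub>\<alpha>\<close>.\<close>

definition reflection :: "real^'n \<Rightarrow> real \<Rightarrow> real^'n \<Rightarrow> real^'n" where
  "reflection \<alpha> n x = x - (\<alpha> \<bullet> x - n) *\<^sub>R coroot \<alpha>"

text \<open>As in Humphreys' book on reflection groups, the roots need not span the whole space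
  (type A is often realised this way), and only \<open>\<plusminus>\<alpha>\<close> are roots among the multiples of a
  root \<open>\<alpha>\<close>.\<close>

definition root_system :: "(real^'n) set \<Rightarrow> bool" where
  "root_system \<Phi> \<longleftrightarrow> finite \<Phi> \<and> 0 \<notin> \<Phi> \<and>
     (\<forall>\<alpha>\<in>\<Phi>. \<Phi> \<inter> span {\<alpha>} = {\<alpha>, - \<alpha>}) \<and>
     (\<forall>\<alpha>\<in>\<Phi>. reflection \<alpha> 0 ` \<Phi> = \<Phi>)"

definition crystallographic :: "(real^'n) set \<Rightarrow> bool" where
  "crystallographic \<Phi> \<longleftrightarrow> (\<forall>\<alpha>\<in>\<Phi>. \<forall>\<beta>\<in>\<Phi>. \<alpha> \<bullet> coroot \<beta> \<in> \<int>)"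

definition irreducible_roots :: "(real^'n) set \<Rightarrow> bool" where
  "irreducible_roots \<Phi> \<longleftrightarrow> \<Phi> \<noteq> {} \<and>
     \<not> (\<exists>\<Phi>1 \<Phi>2. \<Phi>1 \<noteq> {} \<and> \<Phi>2 \<noteq> {} \<and> \<Phi>1 \<inter> \<Phi>2 = {} \<and> \<Phi> = \<Phi>1 \<union> \<Phi>2 \<and>
          (\<forall>\<alpha>\<in>\<Phi>1. \<forall>\<beta>\<in>\<Phi>2. \<alpha> \<bullet> \<beta> = 0))"

definition nonneg_combinations :: "(real^'n) set \<Rightarrow> (real^'n) set" where
  "nonneg_combinations \<Delta> = {(\<Sum>\<alpha>\<in>\<Delta>. c \<alpha> *\<^sub>R \<alpha>) | c. \<forall>\<alpha>\<in>\<Delta>. 0 \<le> (c \<alpha> :: real)}"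

definition simple_system :: "(real^'n) set \<Rightarrow> (real^'n) set \<Rightarrow> bool" where
  "simple_system \<Phi> \<Delta> \<longleftrightarrow> \<Delta> \<subseteq> \<Phi> \<and> independent \<Delta> \<and>
     (\<forall>\<beta>\<in>\<Phi>. \<beta> \<in> nonneg_combinations \<Delta> \<or> - \<beta> \<in> nonneg_combinations \<Delta>)"

definition positive_roots :: "(real^'n) set \<Rightarrow> (real^'n) set \<Rightarrow> (real^'n) set" where
  "positive_roots \<Phi> \<Delta> = \<Phi> \<inter> nonneg_combinations \<Delta>"

definition highest_root :: "(real^'n) set \<Rightarrow> (real^'n) set \<Rightarrow> real^'n \<Rightarrow> bool" where
  "highest_root \<Phi> \<Delta> \<theta> \<longleftrightarrow>
     \<theta> \<in> positive_roots \<Phi> \<Delta> \<and> (\<forall>\<beta>\<in>\<Phi>. \<theta> - \<beta> \<in> nonneg_combinations \<Delta>)"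

text \<open>The group generated by a set of involutions, so that inverses of generators need not be added.\<close>

inductive_set generated_by :: "('a \<Rightarrow> 'a) set \<Rightarrow> ('a \<Rightarrow> 'a) set" for S where
  id: "id \<in> generated_by S"
| step: "s \<in> S \<Longrightarrow> w \<in> generated_by S \<Longrightarrow> s \<circ> w \<in> generated_by S"

definition weyl_group :: "(real^'n) set \<Rightarrow> (real^'n \<Rightarrow> real^'n) set" where
  "weyl_group \<Phi> = generated_by {reflection \<alpha> 0 | \<alpha>. \<alpha> \<in> \<Phi>}"

definition affine_weyl_group :: "(real^'n) set \<Rightarrow> (real^'n) set \<Rightarrow> (real^'n \<Rightarrow> real^'n) set" where
  "affine_weyl_group \<Phi> \<Delta> = generated_by {reflection \<alpha> n | \<alpha> n. \<alpha> \<in> positive_roots \<Phi> \<Delta> \<and> n \<in> \<int>}"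

definition coroot_lattice :: "(real^'n) set \<Rightarrow> (real^'n) set" where
  "coroot_lattice \<Phi> = {(\<Sum>\<alpha>\<in>\<Phi>. k \<alpha> *\<^sub>R coroot \<alpha>) | k. \<forall>\<alpha>\<in>\<Phi>. (k \<alpha> :: real) \<in> \<int>}"

text \<open>If \<open>g = \<tau>(l) w\<close> with \<open>w\<close> linear, then \<open>l = g 0\<close> and \<open>w = linear_part g\<close>; see
  \<open>affine_weyl_group_decomposition\<close> below.\<close>

definition linear_part :: "(real^'n \<Rightarrow> real^'n) \<Rightarrow> real^'n \<Rightarrow> real^'n" where
  "linear_part g = (\<lambda>x. g x - g 0)"

definition sgn_elt :: "(real^'n \<Rightarrow> real^'n) \<Rightarrow> real" where
  "sgn_elt g = det (matrix (linear_part g))"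

lemma linear_weyl_group:
  assumes "w \<in> weyl_group \<Phi>"
  shows "linear w"
  using assms unfolding weyl_group_def
proof (induction rule: generated_by.induct)
  case id
  show ?case by (intro linearI) simp_all
next
  case (step s w)
  then obtain \<alpha> where s: "s = reflection \<alpha> 0"
    by blast
  have "linear s"
    unfolding s reflection_def by (intro linearI) (simp_all add: algebra_simps inner_add_right)
  with step.IH show ?case by (intro linear_compose)
qed

lemma affine_weyl_group_decomposition:
  fixes \<Phi> \<Delta> :: "(real^'n) set"
  assumes fin: "finite \<Phi>" and cryst: "crystallographic \<Phi>"
    and g: "g \<in> affine_weyl_group \<Phi> \<Delta>"
  shows "linear_part g \<in> weyl_group \<Phi> \<and> g 0 \<in> coroot_lattice \<Phi> \<and>
    g = (\<lambda>x. linear_part g x + g 0)"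
  using g unfolding affine_weyl_group_def
proof (induction rule: generated_by.induct)
  case id
  have "linear_part id = (id :: real^'n \<Rightarrow> real^'n)"
    by (simp add: linear_part_def id_def)
  moreover have "(id :: real^'n \<Rightarrow> real^'n) \<in> weyl_group \<Phi>"
    unfolding weyl_group_def by (rule generated_by.id)
  moreover have "id (0 :: real^'n) \<in> coroot_lattice \<Phi>"
    unfolding coroot_lattice_def by (intro CollectI exI[of _ "\<lambda>_. 0"]) simp
  moreover have "id = (\<lambda>x :: real^'n. id x + id 0)"
    by auto
  ultimately show ?case
    by (simp only: simp_thms)
next
  case (step s g)
  then obtain \<alpha> n where s: "s = reflection \<alpha> n" and \<alpha>: "\<alpha> \<in> \<Phi>" and n: "n \<in> \<int>"
    by (auto simp: positive_roots_def)
  from step.IH have IH: "linear_part g \<in> weyl_group \<Phi>" "g 0 \<in> coroot_lattice \<Phi>"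
    by blast+
  have "linear_part (s \<circ> g) = reflection \<alpha> 0 \<circ> linear_part g"
    by (rule ext) (simp add: s linear_part_def reflection_def algebra_simps inner_diff_right)
  moreover have "reflection \<alpha> 0 \<circ> linear_part g \<in> weyl_group \<Phi>"
    using IH(1) \<alpha> unfolding weyl_group_def by (intro generated_by.step) auto
  moreover have "(s \<circ> g) 0 \<in> coroot_lattice \<Phi>"
  proof -
    obtain k where k: "g 0 = (\<Sum>\<beta>\<in>\<Phi>. k \<beta> *\<^sub>R coroot \<beta>)" "\<And>\<beta>. \<beta> \<in> \<Phi> \<Longrightarrow> k \<beta> \<in> \<int>"
      using IH(2) unfolding coroot_lattice_def by blast
    define m where "m = \<alpha> \<bullet> g 0 - n"
    have "m \<in> \<int>"
      using cryst \<alpha> n k(2) unfolding m_def k(1) inner_sum_right crystallographic_def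
      by (auto intro!: Ints_diff Ints_sum Ints_mult )
    have "(s \<circ> g) 0 = g 0 - m *\<^sub>R coroot \<alpha>"
      by (simp add: s reflection_def m_def)
    also have "\<dots> = (\<Sum>\<beta>\<in>\<Phi>. (k \<beta> - (if \<beta> = \<alpha> then m else 0)) *\<^sub>R coroot \<beta>)"
      using fin \<alpha> by (simp add: k(1) scaleR_diff_left sum_subtractf if_distrib[of "\<lambda>c. c *\<^sub>R _"] cong: if_cong)
    finally show ?thesis
      using k(2) \<open>m \<in> \<int>\<close> unfolding coroot_lattice_def
      by (intro CollectI exI[of _ "\<lambda>\<beta>. k \<beta> - (if \<beta> = \<alpha> then m else 0)"]) auto
  qed
  moreover have "s \<circ> g = (\<lambda>x. linear_part (s \<circ> g) x + (s \<circ> g) 0)"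
    by (simp add: linear_part_def fun_eq_iff)
  ultimately show ?case
    by (simp only: simp_thms)
qed


section \<open>Affine roots\<close>

text \<open>Affine roots \<open>(\<alpha>, n)\<close> are pairs in \<open>\<Phi> \<times> \<int>\<close>, where \<open>\<int>\<close> is the set of integers
  inside the reals. In the finite case a root \<open>\<alpha>\<close> is the pair \<open>(\<alpha>, 0)\<close>.\<close>

type_synonym 'n root = "(real^'n) \<times> real"

definition root_eval :: "'n::finite root \<Rightarrow> real^'n \<Rightarrow> real" where
  "root_eval = (\<lambda>(\<alpha>, n) x. \<alpha> \<bullet> x - n)"

definition root_action :: "(real^'n \<Rightarrow> real^'n) \<Rightarrow> 'n root \<Rightarrow> 'n::finite root" where
  "root_action g = (\<lambda>(\<alpha>, n). (linear_part g \<alpha>, n + linear_part g \<alpha> \<bullet> g 0))"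

text \<open>The tuples consist of group, roots, positive roots, simple roots and fundamental region.\<close>

type_synonym 'n reflection_data =
  "(real^'n \<Rightarrow> real^'n) set \<times> 'n root set \<times> 'n root set \<times> 'n root set \<times> (real^'n) set"

definition finite_data :: "(real^'n) set \<Rightarrow> (real^'n) set \<Rightarrow> 'n::finite reflection_data" where
  "finite_data \<Phi> \<Delta> =
     (weyl_group \<Phi>, \<Phi> \<times> {0}, positive_roots \<Phi> \<Delta> \<times> {0}, \<Delta> \<times> {0}, {x. \<forall>\<alpha>\<in>\<Delta>. 0 < \<alpha> \<bullet> x})"

definition affine_positive_roots :: "(real^'n) set \<Rightarrow> (real^'n) set \<Rightarrow> 'n::finite root set" where
  "affine_positive_roots \<Phi> \<Delta> =
     {(\<alpha>, n). \<alpha> \<in> \<Phi> \<and> n \<in> \<int> \<and> (n = 0 \<and> \<alpha> \<in> positive_roots \<Phi> \<Delta> \<or> n \<le> -1)}"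

definition affine_simple_roots :: "(real^'n) set \<Rightarrow> real^'n \<Rightarrow> 'n::finite root set" where
  "affine_simple_roots \<Delta> \<theta> = \<Delta> \<times> {0} \<union> {(- \<theta>, -1)}"

definition affine_data :: "(real^'n) set \<Rightarrow> (real^'n) set \<Rightarrow> real^'n \<Rightarrow> 'n::finite reflection_data" where
  "affine_data \<Phi> \<Delta> \<theta> =
     (affine_weyl_group \<Phi> \<Delta>, \<Phi> \<times> \<int>, affine_positive_roots \<Phi> \<Delta>, affine_simple_roots \<Delta> \<theta>,
      {x. \<forall>r\<in>affine_simple_roots \<Delta> \<theta>. 0 < root_eval r x})"


section \<open>Consistent sets of roots\<close>

definition admissible_elts ::
  "(real^'n \<Rightarrow> real^'n) set \<Rightarrow> 'n root set \<Rightarrow> 'n::finite root set \<Rightarrow> (real^'n \<Rightarrow> real^'n) set" where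
  "admissible_elts W pos I = {w\<in>W. root_action w ` I \<subseteq> pos}"

definition positive_orbit ::
  "(real^'n \<Rightarrow> real^'n) set \<Rightarrow> 'n root set \<Rightarrow> 'n::finite root set \<Rightarrow> 'n root set set" where
  "positive_orbit W pos I = (\<lambda>w. root_action w ` I) ` admissible_elts W pos I"

definition orthogonal_roots :: "'n root \<Rightarrow> 'n::finite root \<Rightarrow> bool" where
  "orthogonal_roots r s \<longleftrightarrow> fst r \<bullet> fst s = 0"

definition consistent ::
  "(real^'n \<Rightarrow> real^'n) set \<Rightarrow> 'n root set \<Rightarrow> 'n root set \<Rightarrow> 'n::finite root set \<Rightarrow> bool" where
  "consistent W pos simple I \<longleftrightarrow>
     (\<exists>J \<subseteq> simple \<inter> I. pairwise orthogonal_roots J \<and>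
        (\<forall>A\<in>positive_orbit W pos I. J \<subseteq> A \<longrightarrow> A = I)) \<and>
     (\<forall>w\<in>W. root_action w ` I = I \<longrightarrow> sgn_elt w = 1) \<and>
     finite (positive_orbit W pos I)"

definition orbit_sign ::
  "(real^'n \<Rightarrow> real^'n) set \<Rightarrow> 'n root set \<Rightarrow> 'n root set \<Rightarrow> 'n::finite root set \<Rightarrow> real" where
  "orbit_sign W pos I A = sgn_elt (SOME w. w \<in> admissible_elts W pos I \<and> root_action w ` I = A)"


section \<open>Reflectable processes\<close>

text \<open>\<open>M\<close> carries the sample space and its measurable sets, \<open>P x\<close> is the probability measure
  under which the process starts at \<open>x\<close>, and only the variables \<open>X t\<close> with \<open>t \<ge> 0\<close> matter.\<close>

definition path_space :: "(real \<Rightarrow> real^'n) measure" where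
  "path_space = (\<Pi>\<^sub>M t\<in>{0..}. borel)"

definition sample_path :: "(real \<Rightarrow> 'w \<Rightarrow> real^'n) \<Rightarrow> 'w \<Rightarrow> real \<Rightarrow> real^'n" where
  "sample_path X \<omega> = (\<lambda>t\<in>{0..}. X t \<omega>)"

definition law :: "(real^'n \<Rightarrow> 'w measure) \<Rightarrow> (real \<Rightarrow> 'w \<Rightarrow> real^'n) \<Rightarrow> real^'n \<Rightarrow> (real \<Rightarrow> real^'n) measure"
  where "law P X x = distr (P x) path_space (sample_path X)"

definition process_family ::
  "'w measure \<Rightarrow> (real^'n \<Rightarrow> 'w measure) \<Rightarrow> (real \<Rightarrow> 'w \<Rightarrow> real^'n) \<Rightarrow> bool" where
  "process_family M P X \<longleftrightarrow>
     (\<forall>x. prob_space (P x) \<and> sets (P x) = sets M) \<and>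
     (\<forall>t\<ge>0. X t \<in> borel_measurable M) \<and>
     (\<forall>x. AE \<omega> in P x. X 0 \<omega> = x)"

definition natural_filtration :: "'w measure \<Rightarrow> (real \<Rightarrow> 'w \<Rightarrow> real^'n) \<Rightarrow> ennreal \<Rightarrow> 'w measure" where
  "natural_filtration M X t =
     sigma (space M) {X s -` B \<inter> space M | s B. 0 \<le> s \<and> ennreal s \<le> t \<and> B \<in> sets borel}"

text \<open>For a stopping time \<open>T\<close> and an event \<open>B\<close> of paths, the conditional probability of
  \<open>(X (T + s))\<^sub>s \<in> B\<close> given \<open>\<F>\<^sub>T\<close> is, on \<open>T < \<infinity>\<close>, the probability of \<open>B\<close> for the process
  restarted at \<open>X T\<close>. The completion is needed because the paths will only be almost surely
  continuous, so that \<open>X T\<close> need not be measurable with respect to \<open>M\<close> itself. The natural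
  filtration gives the weakest form of the property: any strong Markov property with respect to
  a larger filtration implies this one.\<close>

definition strong_markov ::
  "'w measure \<Rightarrow> (real^'n \<Rightarrow> 'w measure) \<Rightarrow> (real \<Rightarrow> 'w \<Rightarrow> real^'n) \<Rightarrow> bool" where
  "strong_markov M P X \<longleftrightarrow>
     law P X \<in> borel \<rightarrow>\<^sub>M prob_algebra path_space \<and>
     (\<forall>x T B. stopping_time (natural_filtration M X) T \<longrightarrow> B \<in> sets path_space \<longrightarrow>
        (AE \<omega> in P x. T \<omega> < \<infinity> \<longrightarrow>
           real_cond_exp (completion (P x))
             (filtration.pre_sigma (space M) (natural_filtration M X) T)
             (indicator {\<omega>. T \<omega> < \<infinity> \<and> sample_path (\<lambda>s. X (enn2real (T \<omega>) + s)) \<omega> \<in> B}) \<omega>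
           = measure (law P X (X (enn2real (T \<omega>)) \<omega>)) B))"

definition reflectable ::
  "(real^'n \<Rightarrow> real^'n) set \<Rightarrow> 'w measure \<Rightarrow> (real^'n \<Rightarrow> 'w measure) \<Rightarrow> (real \<Rightarrow> 'w \<Rightarrow> real^'n) \<Rightarrow> bool" where
  "reflectable W M P X \<longleftrightarrow>
     process_family M P X \<and>
     strong_markov M P X \<and>
     (\<forall>x. AE \<omega> in P x. continuous_on {0..} (\<lambda>t. X t \<omega>)) \<and>
     (\<forall>w\<in>W. \<forall>x. distr (P x) path_space (sample_path (\<lambda>t \<omega>. w (X t \<omega>))) = law P X (w x))"

definition hitting_time :: "(real \<Rightarrow> 'w \<Rightarrow> real^'n) \<Rightarrow> 'n::finite root \<Rightarrow> 'w \<Rightarrow> ennreal" where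
  "hitting_time X r \<omega> = Inf {ennreal t | t. 0 \<le> t \<and> root_eval r (X t \<omega>) = 0}"

text \<open>\<open>A\<close> may be infinite in the affine case, hence an infimum instead of a minimum.\<close>

definition set_hitting_time :: "(real \<Rightarrow> 'w \<Rightarrow> real^'n) \<Rightarrow> 'n::finite root set \<Rightarrow> 'w \<Rightarrow> ennreal" where
  "set_hitting_time X A \<omega> = (INF r\<in>A. hitting_time X r \<omega>)"

text \<open>With paths that are only almost surely continuous, the event belongs to the completed
  \<open>\<sigma>\<close>-algebra.\<close>

definition survival_prob ::
  "'w measure \<Rightarrow> (real \<Rightarrow> 'w \<Rightarrow> real^'n) \<Rightarrow> 'n::finite root set \<Rightarrow> real \<Rightarrow> real" where
  "survival_prob N X A t = measure (completion N) {\<omega>\<in>space N. ennreal t < set_hitting_time X A \<omega>}"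

end

theory Submission
  imports Defs
begin

text \<open>On the event that the process has not left \<open>F\<close> by time \<open>t\<close> it has met no hyperplane of a
  positive root, so all the events \<open>T\<^sub>A > t\<close> hold there; the signs add up to 1 because the reflection
  in a root of \<open>J\<close> missing from \<open>A\<close> pairs off all \<open>A \<noteq> I\<close> with opposite signs. If the process leaves
  \<open>F\<close> before \<open>t\<close>, it does so on the hyperplane of some simple root \<open>\<alpha>\<close>. After that time its law is
  invariant under \<open>s\<^sub>\<alpha>\<close>, hence \<open>A\<close> and \<open>s\<^sub>\<alpha> A\<close> contribute equally with opposite signs, while sets
  containing \<open>\<alpha>\<close> contribute nothing.\<close>

text \<open>Several simple roots may vanish at once where the path leaves \<open>F\<close>. Paths
  are therefore sorted by the full set \<open>S\<close> of simple roots vanishing at the exit point,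
  not by one chosen wall; for nonempty \<open>S\<close> any \<open>r\<close> in \<open>S\<close> can
  serve as the reflecting root. No positive root vanishes on \<open>F\<close>, so after an exit at
  or before \<open>t\<close> the event T_A > t depends only on the exit time and on the path after
  it. Invariance under the reflection in \<open>r\<close> is proved for every restart point: on
  paths whose set of vanishing simple roots at time 0 is \<open>S\<close>, both sides are 0 unless
  the restart point lies on the hyperplane of \<open>r\<close>. This turns the strong Markov
  property into an equality of probabilities. Both cases of the theorem are treated at once, from a
  short list of properties; the geometric ones are that a simple reflection permutes the other
  positive roots and that positive roots are positive on \<open>F\<close>. Since only almost every
  path is continuous, events are described through a modification all of whose paths are continuous,
  while the strong Markov property is applied to the original process.\<close>

section \<open>Reflections and consistent sets of roots\<close>

text \<open>An orthogonal map \<open>f\<close> taking a coordinate axis to the line of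
  \<open>\<alpha>\<close> conjugates the reflection to the diagonal map \<open>D\<close>, which has
  a single entry -1 on its diagonal.\<close>

lemma det_reflection:
  fixes \<alpha> :: "real^'n"
  assumes "\<alpha> \<noteq> 0"
  shows "det (matrix (reflection \<alpha> 0)) = -1"
proof -
  fix k :: 'n
  let ?e = "axis k 1 :: real^'n"
  have "norm (norm \<alpha> *\<^sub>R ?e) = norm \<alpha>" by simp
  then obtain f where f: "orthogonal_transformation f" "f (norm \<alpha> *\<^sub>R ?e) = \<alpha>"
    by (rule orthogonal_transformation_exists)
  have lf: "linear f" using f(1) by (simp add: orthogonal_transformation_linear)
  have fi: "f v \<bullet> f w = v \<bullet> w" for v w using f(1) by (simp add: orthogonal_transformation_def)
  have fe: "\<alpha> = norm \<alpha> *\<^sub>R f ?e" using f(2) lf by (simp add: linear_scale)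
  define D where "D = (\<lambda>x::real^'n. x - (2 * x $ k) *\<^sub>R ?e)"
  have linD: "linear D"
    unfolding D_def by (intro linearI) (auto simp: algebra_simps vec_eq_iff axis_def)
  have linR: "linear (reflection \<alpha> 0)"
    unfolding reflection_def by (intro linearI) (simp_all add: algebra_simps inner_add_right)
  have comm: "reflection \<alpha> 0 \<circ> f = f \<circ> D"
  proof
    fix x
    have "\<alpha> \<bullet> f x = norm \<alpha> * (x $ k)"
      by (subst fe) (simp add: fi inner_commute[of ?e] inner_axis)
    moreover have "\<alpha> \<bullet> \<alpha> = norm \<alpha> * norm \<alpha>" by (simp add: dot_square_norm power2_eq_square)
    ultimately have "reflection \<alpha> 0 (f x) = f x - (2 * x $ k / norm \<alpha>) *\<^sub>R \<alpha>"
      using assms by (simp add: reflection_def coroot_def field_simps)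
    also have "\<dots> = f x - (2 * x $ k) *\<^sub>R f ?e"
      using assms by (subst (2) fe) simp
    also have "\<dots> = f (D x)"
      unfolding D_def using lf by (simp add: linear_diff linear_scale)
    finally show "(reflection \<alpha> 0 \<circ> f) x = (f \<circ> D) x" by simp
  qed
  have "det (matrix (reflection \<alpha> 0)) * det (matrix f) = det (matrix f) * det (matrix D)"
    using arg_cong[OF comm, of "\<lambda>g. det (matrix g)"] linR lf linD
    by (simp add: matrix_compose det_mul)
  moreover have "det (matrix f) \<noteq> 0"
    using f(1) det_orthogonal_matrix orthogonal_transformation_matrix by fastforce
  moreover have "det (matrix D) = -1"
  proof -
    have "det (matrix D) = prod (\<lambda>i. matrix D $ i $ i) UNIV"
      by (rule det_diagonal) (auto simp: matrix_def D_def axis_def)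
    also have "\<dots> = prod (\<lambda>i. if i = k then -1 else 1) UNIV"
      by (intro prod.cong) (auto simp: matrix_def D_def axis_def)
    finally show ?thesis by simp
  qed
  ultimately have "(det (matrix (reflection \<alpha> 0)) + 1) * det (matrix f) = 0"
    by (simp add: algebra_simps)
  with \<open>det (matrix f) \<noteq> 0\<close> show ?thesis by simp
qed

section \<open>Affine maps acting on roots, and their signs\<close>

lemma linear_part_reflection: "linear_part (reflection \<alpha> n) = reflection \<alpha> 0"
  by (auto simp: linear_part_def reflection_def algebra_simps)

lemma reflection_at_zero: "reflection \<alpha> n 0 = n *\<^sub>R coroot \<alpha>"
  by (simp add: reflection_def)

lemma inner_coroot_self: "\<alpha> \<noteq> 0 \<Longrightarrow> \<alpha> \<bullet> coroot \<alpha> = 2"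
  by (simp add: coroot_def)

lemma reflection_involution: "\<alpha> \<noteq> 0 \<Longrightarrow> reflection \<alpha> n (reflection \<alpha> n x) = x"
  by (simp add: reflection_def inner_diff_right inner_coroot_self algebra_simps flip: scaleR_add_left)

text \<open>Opposite normals with opposite levels give the same hyperplane. The generators of the
  affine Weyl group are indexed by positive roots, so the affine simple root
  \<open>(- \<theta>, -1)\<close> is handled as \<open>reflection \<theta> 1\<close>.\<close>

lemma reflection_uminus: "reflection (- \<alpha>) (- n) = reflection \<alpha> n"
  by (rule ext) (simp add: reflection_def coroot_def algebra_simps flip: scaleR_left.add add_divide_distrib)

lemma inner_reflection:
  "reflection \<alpha> 0 x \<bullet> y = x \<bullet> y - (\<alpha> \<bullet> x) * (coroot \<alpha> \<bullet> y)"
  by (simp add: reflection_def inner_diff_left)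

lemma orthogonal_reflection:
  assumes "\<alpha> \<noteq> 0"
  shows "orthogonal_transformation (reflection \<alpha> 0)"
proof -
  have "linear (reflection \<alpha> 0)"
    unfolding reflection_def by (intro linearI) (simp_all add: algebra_simps inner_add_right)
  moreover have "reflection \<alpha> 0 v \<bullet> reflection \<alpha> 0 w = v \<bullet> w" for v w
    using assms
    by (simp add: reflection_def coroot_def inner_diff_left inner_diff_right inner_commute field_simps)
  ultimately show ?thesis by (simp add: orthogonal_transformation_def)
qed

lemma root_action_reflection:
  assumes "\<alpha> \<noteq> 0"
  shows "root_action (reflection \<alpha> m) (\<beta>, n) = (reflection \<alpha> 0 \<beta>, n - m * (\<beta> \<bullet> coroot \<alpha>))"
  using assms
  by (simp add: root_action_def linear_part_reflection reflection_at_zero inner_reflection)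
     (simp add: coroot_def inner_commute field_simps)

lemma root_action_id: "root_action id r = r"
  by (cases r) (simp add: root_action_def linear_part_def)

lemma apply_linear_part: "g x = linear_part g x + g 0"
  by (simp add: linear_part_def)

lemma linear_part_comp:
  assumes "linear (linear_part g)"
  shows "linear_part (g \<circ> h) = linear_part g \<circ> linear_part h"
proof
  fix x
  have "linear_part g (h x - h 0) = linear_part g (h x) - linear_part g (h 0)"
    using assms by (rule linear_diff)
  then show "linear_part (g \<circ> h) x = (linear_part g \<circ> linear_part h) x"
    by (simp add: linear_part_def)
qed

text \<open>The level of a root changes by an inner product with the translation part; the linear
  part of \<open>g\<close> preserves inner products, so the contribution of \<open>h\<close>
  survives unchanged.\<close>

lemma root_action_comp:
  assumes "orthogonal_transformation (linear_part g)"
  shows "root_action (g \<circ> h) r = root_action g (root_action h r)"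
proof -
  obtain \<alpha> n where r: "r = (\<alpha>, n)" by (cases r)
  have "linear_part g (linear_part h \<alpha>) \<bullet> linear_part g (h 0) = linear_part h \<alpha> \<bullet> h 0"
    using assms by (simp add: orthogonal_transformation_def)
  then show ?thesis
    using assms by (simp add: r root_action_def linear_part_comp orthogonal_transformation_linear
        apply_linear_part[of g "h 0"] inner_add_right)
qed

text \<open>This is the meaning of the level shift in \<open>root_action\<close>: \<open>g\<close>
  carries the hyperplane of a root to the hyperplane of its image.\<close>

lemma root_eval_root_action:
  assumes "orthogonal_transformation (linear_part g)"
  shows "root_eval (root_action g r) (g x) = root_eval r x"
proof -
  obtain \<alpha> n where r: "r = (\<alpha>, n)" by (cases r)
  have "linear_part g \<alpha> \<bullet> linear_part g x = \<alpha> \<bullet> x"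
    using assms by (simp add: orthogonal_transformation_def)
  then show ?thesis
    by (simp add: r root_action_def root_eval_def apply_linear_part[of g x] inner_add_right)
qed

lemma sgn_elt_comp:
  assumes "linear (linear_part g)" "linear (linear_part h)"
  shows "sgn_elt (g \<circ> h) = sgn_elt g * sgn_elt h"
  using assms by (simp add: sgn_elt_def linear_part_comp matrix_compose det_mul)

lemma sgn_elt_id: "sgn_elt (id :: real^'n \<Rightarrow> real^'n) = 1"
proof -
  have "linear_part id = (id :: real^'n \<Rightarrow> real^'n)" by (auto simp: linear_part_def)
  then show ?thesis by (simp add: sgn_elt_def matrix_id_mat_1)
qed

lemma sgn_elt_reflection: "\<alpha> \<noteq> 0 \<Longrightarrow> sgn_elt (reflection \<alpha> n) = -1"
  by (simp add: sgn_elt_def linear_part_reflection det_reflection)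

text \<open>Fixed points of \<open>h\<close> are allowed: the sign change forces \<open>f\<close> to
  vanish there.\<close>

lemma sum_involution_eq_0:
  fixes f :: "'a \<Rightarrow> real"
  assumes "\<And>a. a \<in> S \<Longrightarrow> h a \<in> S \<and> h (h a) = a \<and> f (h a) = - f a"
  shows "sum f S = 0"
proof -
  have "sum f S = sum (\<lambda>a. f (h a)) S"
    using assms by (intro sum.reindex_bij_witness[of _ h h]) auto
  also have "\<dots> = - sum f S"
    using assms by (simp add: sum_negf cong: sum.cong)
  finally show ?thesis by simp
qed

section \<open>Properties common to the finite and the affine case\<close>

definition root_reflection :: "'n::finite root \<Rightarrow> real^'n \<Rightarrow> real^'n" where
  "root_reflection r = reflection (fst r) (snd r)"

text \<open>The interface between root systems and probability. \<open>permute_pos\<close> keeps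
  reflected sets positive, \<open>pos_on_F\<close> excludes hitting a positive hyperplane before the
  exit, and \<open>countable_pos\<close> serves measurability, as the affine case has infinitely
  many positive roots.\<close>

locale reflection_setting =
  fixes W :: "(real^'n \<Rightarrow> real^'n) set" and pos simple :: "'n::finite root set" and F :: "(real^'n) set"
  assumes id_in_W: "id \<in> W"
    and comp_in_W: "\<And>g h. g \<in> W \<Longrightarrow> h \<in> W \<Longrightarrow> g \<circ> h \<in> W"
    and inverse_in_W: "\<And>g. g \<in> W \<Longrightarrow> \<exists>h\<in>W. h \<circ> g = id \<and> g \<circ> h = id"
    and orthogonal_W: "\<And>g. g \<in> W \<Longrightarrow> orthogonal_transformation (linear_part g)"
    and finite_simple: "finite simple"
    and simple_pos: "simple \<subseteq> pos"
    and simple_nonzero: "\<And>r. r \<in> simple \<Longrightarrow> fst r \<noteq> 0"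
    and countable_pos: "countable pos"
    and root_reflection_in_W: "\<And>r. r \<in> simple \<Longrightarrow> root_reflection r \<in> W"
    and uminus_notin_pos: "\<And>r. r \<in> pos \<Longrightarrow> - r \<notin> pos"
    and permute_pos: "\<And>r s. r \<in> simple \<Longrightarrow> s \<in> pos \<Longrightarrow> s \<noteq> r \<Longrightarrow> root_action (root_reflection r) s \<in> pos"
    and F_eq: "F = {x. \<forall>r\<in>simple. 0 < root_eval r x}"
    and pos_on_F: "\<And>r x. r \<in> pos \<Longrightarrow> x \<in> F \<Longrightarrow> 0 < root_eval r x"
begin

lemma linear_W: "g \<in> W \<Longrightarrow> linear (linear_part g)"
  using orthogonal_W orthogonal_transformation_linear by blast

abbreviation reflect :: "'n root \<Rightarrow> 'n root set \<Rightarrow> 'n root set" where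
  "reflect r A \<equiv> root_action (root_reflection r) ` A"

lemma root_reflection_involution: "r \<in> simple \<Longrightarrow> root_reflection r \<circ> root_reflection r = id"
  using simple_nonzero[of r] by (simp add: fun_eq_iff root_reflection_def reflection_involution)

lemma root_action_root_reflection_involution:
  "r \<in> simple \<Longrightarrow> root_action (root_reflection r) (root_action (root_reflection r) s) = s"
  by (simp add: root_action_comp[symmetric] orthogonal_W root_reflection_in_W
      root_reflection_involution root_action_id)

lemma reflect_reflect: "r \<in> simple \<Longrightarrow> reflect r (reflect r A) = A"
  by (simp add: image_image root_action_root_reflection_involution)

lemma root_action_self: "r \<in> simple \<Longrightarrow> root_action (root_reflection r) r = - r"
  using simple_nonzero[of r]
  by (cases r) (simp add: root_reflection_def root_action_reflection inner_coroot_self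
      reflection_def coroot_def scaleR_2)

text \<open>Only \<open>- r\<close> is sent to \<open>r\<close>, and \<open>- r\<close> is not
  positive.\<close>

lemma notin_reflect:
  assumes "r \<in> simple" "A \<subseteq> pos"
  shows "r \<notin> reflect r A"
proof
  assume "r \<in> reflect r A"
  then obtain s where s: "s \<in> A" "r = root_action (root_reflection r) s" by blast
  then have "s = - r"
    using assms(1) root_action_self root_action_root_reflection_involution by metis
  then show False
    using s assms uminus_notin_pos[of r] simple_pos by auto
qed

text \<open>The level of \<open>s\<close> moves by a multiple of the inner product of the vector
  parts, so orthogonality of these parts suffices whatever the levels are.\<close>

lemma root_action_orthogonal:
  assumes "r \<in> simple" "orthogonal_roots r s"
  shows "root_action (root_reflection r) s = s"
  using assms simple_nonzero[of r]
  by (cases r; cases s) (simp add: root_reflection_def root_action_reflection orthogonal_roots_def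
      reflection_def coroot_def inner_commute)

end

section \<open>Signs and cancellation on the orbit of a consistent set\<close>

locale consistent_set = reflection_setting W pos simple F
  for W :: "(real^'n \<Rightarrow> real^'n) set" and pos simple :: "'n::finite root set" and F +
  fixes I :: "'n root set"
  assumes I_pos: "I \<subseteq> pos" and consistent_I: "consistent W pos simple I"
begin

abbreviation "orbit \<equiv> positive_orbit W pos I"

abbreviation "\<epsilon> \<equiv> orbit_sign W pos I"

lemma finite_orbit: "finite orbit"
  using consistent_I by (simp add: consistent_def)

lemma orbit_pos: "A \<in> orbit \<Longrightarrow> A \<subseteq> pos"
  by (auto simp: positive_orbit_def admissible_elts_def)

text \<open>Two elements carrying \<open>I\<close> to \<open>A\<close> differ by an element
  stabilising \<open>I\<close>, whose sign is 1 by (C2). Hence the choice inside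
  \<open>orbit_sign\<close> is harmless.\<close>

lemma orbit_sign_eq:
  assumes "w \<in> admissible_elts W pos I" "root_action w ` I = A"
  shows "\<epsilon> A = sgn_elt w"
proof -
  define v where "v = (SOME w. w \<in> admissible_elts W pos I \<and> root_action w ` I = A)"
  have v: "v \<in> admissible_elts W pos I \<and> root_action v ` I = A"
    unfolding v_def by (rule someI[of _ w]) (use assms in simp)
  have vw: "v \<in> W" "w \<in> W" using v assms by (auto simp: admissible_elts_def)
  obtain u where u: "u \<in> W" "u \<circ> w = id" using inverse_in_W vw by blast
  have "root_action (u \<circ> v) ` I = root_action u ` root_action v ` I"
    using u(1) by (simp add: image_image root_action_comp orthogonal_W)
  also have "\<dots> = root_action u ` root_action w ` I" using v assms by simp
  also have "\<dots> = root_action (u \<circ> w) ` I"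
    using u(1) by (simp add: image_image root_action_comp orthogonal_W)
  finally have "root_action (u \<circ> v) ` I = I" by (simp add: u(2) root_action_id)
  then have "sgn_elt (u \<circ> v) = 1"
    using consistent_I u vw by (auto simp: consistent_def comp_in_W)
  then have *: "sgn_elt u * sgn_elt v = 1" using u vw by (simp add: sgn_elt_comp linear_W)
  have "sgn_elt u * sgn_elt w = sgn_elt (u \<circ> w)" using u(1) vw by (simp add: sgn_elt_comp linear_W)
  also have "\<dots> = 1" by (simp add: u(2) sgn_elt_id)
  finally have "sgn_elt u * sgn_elt v = sgn_elt u * sgn_elt w" "sgn_elt u \<noteq> 0"
    using * by auto
  then have "sgn_elt v = sgn_elt w" by simp
  then show ?thesis by (simp add: orbit_sign_def v_def)
qed

lemma I_in_orbit: "I \<in> orbit" and orbit_sign_I: "\<epsilon> I = 1"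
proof -
  have *: "id \<in> admissible_elts W pos I" "root_action id ` I = I"
    using I_pos by (auto simp: admissible_elts_def id_in_W root_action_id)
  show "I \<in> orbit" unfolding positive_orbit_def using * by (metis imageI)
  show "\<epsilon> I = 1" using orbit_sign_eq[OF *] by (simp add: sgn_elt_id)
qed

text \<open>As \<open>r\<close> is not in \<open>A\<close>, the simple reflection sends all of
  \<open>A\<close> to positive roots. Composing with it therefore gives another admissible element,
  with determinant of opposite sign.\<close>

lemma
  assumes "A \<in> orbit" "r \<in> simple" "r \<notin> A"
  shows reflect_in_orbit: "reflect r A \<in> orbit"
    and orbit_sign_reflect: "\<epsilon> (reflect r A) = - \<epsilon> A"
proof -
  obtain w where w: "w \<in> admissible_elts W pos I" "root_action w ` I = A"
    using assms(1) by (auto simp: positive_orbit_def)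
  let ?v = "root_reflection r \<circ> w"
  have wW: "w \<in> W" and A: "A \<subseteq> pos" using w by (auto simp: admissible_elts_def)
  have img: "root_action ?v ` I = reflect r A"
    using w assms(2) by (auto simp: image_image root_action_comp orthogonal_W root_reflection_in_W)
  have "reflect r A \<subseteq> pos"
    using A assms permute_pos by fastforce
  then have v: "?v \<in> admissible_elts W pos I"
    using img wW assms(2) by (simp add: admissible_elts_def comp_in_W root_reflection_in_W)
  show "reflect r A \<in> orbit"
    unfolding positive_orbit_def using v img by (metis imageI)
  have "\<epsilon> (reflect r A) = sgn_elt ?v" using orbit_sign_eq[OF v img] .
  also have "\<dots> = sgn_elt (root_reflection r) * sgn_elt w"
    using wW assms(2) by (simp add: sgn_elt_comp linear_W root_reflection_in_W)
  also have "\<dots> = - \<epsilon> A"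
    using orbit_sign_eq[OF w] simple_nonzero[OF assms(2)]
    by (simp add: root_reflection_def sgn_elt_reflection)
  finally show "\<epsilon> (reflect r A) = - \<epsilon> A" .
qed

lemma sum_orbit_sign: "(\<Sum>A\<in>orbit. \<epsilon> A) = 1"
proof -
  obtain J where J: "J \<subseteq> simple \<inter> I" "pairwise orthogonal_roots J"
    and JA: "\<And>A. A \<in> orbit \<Longrightarrow> J \<subseteq> A \<Longrightarrow> A = I"
    using consistent_I unfolding consistent_def by metis
  \<comment> \<open>The choice depends on \<open>A\<close> only through \<open>J - A\<close>. It is
    enough that the reflection leaves this set unchanged for the pairing to be an
    involution.\<close>
  define c where "c A = (SOME r. r \<in> J - A)" for A :: "'n root set"
  have "(\<Sum>A\<in>orbit - {I}. \<epsilon> A) = 0"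
  proof (rule sum_involution_eq_0[where h = "\<lambda>A. reflect (c A) A"])
    fix A assume A: "A \<in> orbit - {I}"
    then have "\<exists>r. r \<in> J - A" using JA by blast
    then have r: "c A \<in> J - A" unfolding c_def by (rule someI_ex)
    then have s: "c A \<in> simple" using J by auto
    let ?B = "reflect (c A) A"
    have "c A \<notin> ?B" using s A orbit_pos notin_reflect by blast
    have fixJ: "root_action (root_reflection (c A)) b = b" if "b \<in> J" "b \<noteq> c A" for b
      using that r J s by (intro root_action_orthogonal) (auto simp: pairwise_def)
    \<comment> \<open>Orthogonality makes the reflection fix the other roots of \<open>J\<close>,
      and \<open>c A\<close> lies in neither \<open>A\<close> nor \<open>?B\<close>.\<close>
    have "J - ?B = J - A"
    proof (intro set_eqI)
      fix b
      show "b \<in> J - ?B \<longleftrightarrow> b \<in> J - A"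
      proof (cases "b \<in> J \<and> b \<noteq> c A")
        case True
        then have fb: "root_action (root_reflection (c A)) b = b" using fixJ by blast
        have "b \<in> ?B \<longleftrightarrow> b \<in> A"
        proof
          assume "b \<in> ?B"
          then obtain a where "a \<in> A" "b = root_action (root_reflection (c A)) a" by blast
          then show "b \<in> A" using fb root_action_root_reflection_involution[OF s, of a] by simp
        next
          assume "b \<in> A"
          then show "b \<in> ?B" using fb by (intro image_eqI[of _ _ b]) simp_all
        qed
        then show ?thesis by simp
      qed (use r \<open>c A \<notin> ?B\<close> in auto)
    qed
    then have "c ?B = c A" by (simp add: c_def)
    then have "reflect (c ?B) ?B = A" using reflect_reflect[OF s] by simp
    moreover have "?B \<noteq> I" using \<open>c A \<notin> ?B\<close> r J by auto
    ultimately show "?B \<in> orbit - {I} \<and> reflect (c ?B) ?B = A \<and> \<epsilon> ?B = - \<epsilon> A"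
      using A r s reflect_in_orbit orbit_sign_reflect by blast
  qed
  then show ?thesis
    using finite_orbit I_in_orbit orbit_sign_I by (simp add: sum.remove)
qed

text \<open>To be applied with \<open>f A\<close> the probability of surviving after an exit at a
  point where \<open>r\<close> vanishes.\<close>

lemma sum_orbit_eq_0:
  assumes "r \<in> simple" and "\<And>A. A \<in> orbit \<Longrightarrow> r \<in> A \<Longrightarrow> f A = 0"
    and "\<And>A. A \<in> orbit \<Longrightarrow> r \<notin> A \<Longrightarrow> f (reflect r A) = f A"
  shows "(\<Sum>A\<in>orbit. \<epsilon> A * f A) = (0::real)"
proof -
  have "(\<Sum>A\<in>orbit. \<epsilon> A * f A) = (\<Sum>A\<in>{A\<in>orbit. r \<notin> A}. \<epsilon> A * f A)"
    using finite_orbit assms(2) by (intro sum.mono_neutral_right) auto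
  also have "\<dots> = 0"
    using assms reflect_in_orbit orbit_sign_reflect reflect_reflect notin_reflect orbit_pos
    by (intro sum_involution_eq_0[where h = "reflect r"]) auto
  finally show ?thesis .
qed

end

section \<open>Finite and affine Weyl groups\<close>

lemma generated_by_comp:
  "g \<in> generated_by S \<Longrightarrow> h \<in> generated_by S \<Longrightarrow> g \<circ> h \<in> generated_by S"
  by (induction rule: generated_by.induct) (simp_all add: comp_assoc generated_by.step)

lemma generated_by_generator: "s \<in> S \<Longrightarrow> s \<in> generated_by S"
  using generated_by.step[OF _ generated_by.id, of s S] by simp

lemma generated_by_inverse:
  assumes "\<And>s. s \<in> S \<Longrightarrow> s \<circ> s = id" "g \<in> generated_by S"
  shows "\<exists>h\<in>generated_by S. h \<circ> g = id \<and> g \<circ> h = id"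
  using assms(2)
proof (induction rule: generated_by.induct)
  case id
  show ?case by (rule bexI[of _ id]) (simp_all add: generated_by.id)
next
  case (step s w)
  then obtain h where h: "h \<in> generated_by S" "h \<circ> w = id" "w \<circ> h = id" by blast
  have s: "s \<circ> s = id" using step assms by blast
  have "h \<circ> s \<circ> (s \<circ> w) = h \<circ> (s \<circ> s) \<circ> w" "s \<circ> w \<circ> (h \<circ> s) = s \<circ> (w \<circ> h) \<circ> s"
    by (simp_all add: comp_assoc)
  then have "h \<circ> s \<circ> (s \<circ> w) = id" "s \<circ> w \<circ> (h \<circ> s) = id" using s h by simp_all
  moreover have "h \<circ> s \<in> generated_by S"
    using generated_by_comp[OF h(1) generated_by_generator[OF step(1)]] .
  ultimately show ?case by blast
qed

lemma generated_by_reflections_orthogonal: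
  assumes "\<And>s. s \<in> S \<Longrightarrow> \<exists>\<alpha> n. \<alpha> \<noteq> 0 \<and> s = reflection \<alpha> n" "g \<in> generated_by S"
  shows "orthogonal_transformation (linear_part g)"
  using assms(2)
proof (induction rule: generated_by.induct)
  case id
  have "linear_part id = (id :: real^'a \<Rightarrow> real^'a)" by (auto simp: linear_part_def)
  moreover have "orthogonal_transformation (id :: real^'a \<Rightarrow> real^'a)"
    by (simp add: orthogonal_transformation_def linear_iff)
  ultimately show ?case by (simp only:)
next
  case (step s w)
  then obtain \<alpha> n where "\<alpha> \<noteq> 0" "s = reflection \<alpha> n" using assms by blast
  then have "orthogonal_transformation (linear_part s)"
    by (simp add: linear_part_reflection orthogonal_reflection)
  then show ?case
    using step.IH linear_part_comp[of s w] orthogonal_transformation_compose[of "linear_part s" "linear_part w"]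
    by (simp only: orthogonal_transformation_linear)
qed

section \<open>The cone spanned by the simple roots\<close>

lemma nonneg_combinationsI:
  "v = (\<Sum>\<alpha>\<in>\<Delta>. c \<alpha> *\<^sub>R \<alpha>) \<Longrightarrow> (\<And>\<alpha>. \<alpha> \<in> \<Delta> \<Longrightarrow> 0 \<le> c \<alpha>) \<Longrightarrow> v \<in> nonneg_combinations \<Delta>"
  by (auto simp: nonneg_combinations_def)

lemma nonneg_combinationsE:
  assumes "v \<in> nonneg_combinations \<Delta>"
  obtains c where "v = (\<Sum>\<alpha>\<in>\<Delta>. c \<alpha> *\<^sub>R \<alpha>)" "\<And>\<alpha>. \<alpha> \<in> \<Delta> \<Longrightarrow> 0 \<le> c \<alpha>"
  using assms by (auto simp: nonneg_combinations_def)

lemma nonneg_combinations_add: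
  assumes "v \<in> nonneg_combinations \<Delta>" "w \<in> nonneg_combinations \<Delta>"
  shows "v + w \<in> nonneg_combinations \<Delta>"
proof -
  obtain c where c: "v = (\<Sum>\<alpha>\<in>\<Delta>. c \<alpha> *\<^sub>R \<alpha>)" "\<And>\<alpha>. \<alpha> \<in> \<Delta> \<Longrightarrow> 0 \<le> c \<alpha>"
    using nonneg_combinationsE[OF assms(1)] by blast
  obtain d where d: "w = (\<Sum>\<alpha>\<in>\<Delta>. d \<alpha> *\<^sub>R \<alpha>)" "\<And>\<alpha>. \<alpha> \<in> \<Delta> \<Longrightarrow> 0 \<le> d \<alpha>"
    using nonneg_combinationsE[OF assms(2)] by blast
  show ?thesis
    by (rule nonneg_combinationsI[of _ "\<lambda>\<alpha>. c \<alpha> + d \<alpha>"])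
       (simp_all add: c d scaleR_add_left sum.distrib)
qed

lemma nonneg_combinations_scale:
  assumes "v \<in> nonneg_combinations \<Delta>" "0 \<le> a"
  shows "a *\<^sub>R v \<in> nonneg_combinations \<Delta>"
proof -
  obtain c where c: "v = (\<Sum>\<alpha>\<in>\<Delta>. c \<alpha> *\<^sub>R \<alpha>)" "\<And>\<alpha>. \<alpha> \<in> \<Delta> \<Longrightarrow> 0 \<le> c \<alpha>"
    using nonneg_combinationsE[OF assms(1)] by blast
  show ?thesis
    by (rule nonneg_combinationsI[of _ "\<lambda>\<alpha>. a * c \<alpha>"])
       (simp_all add: c assms scaleR_sum_right)
qed

lemma nonneg_combinations_inner:
  assumes "v \<in> nonneg_combinations \<Delta>" "\<And>\<alpha>. \<alpha> \<in> \<Delta> \<Longrightarrow> 0 \<le> \<alpha> \<bullet> x"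
  shows "0 \<le> v \<bullet> x"
proof -
  obtain c where "v = (\<Sum>\<alpha>\<in>\<Delta>. c \<alpha> *\<^sub>R \<alpha>)" "\<And>\<alpha>. \<alpha> \<in> \<Delta> \<Longrightarrow> 0 \<le> c \<alpha>"
    using nonneg_combinationsE[OF assms(1)] by blast
  then show ?thesis using assms(2) by (auto simp: inner_sum_left intro!: sum_nonneg)
qed

locale based_root_system =
  fixes \<Phi> \<Delta> :: "(real^'n) set"
  assumes root_system: "root_system \<Phi>" and simple_system: "simple_system \<Phi> \<Delta>"
begin

abbreviation "K \<equiv> nonneg_combinations \<Delta>"

lemma finite_\<Phi>: "finite \<Phi>" and zero_notin: "0 \<notin> \<Phi>"
  and multiples: "\<alpha> \<in> \<Phi> \<Longrightarrow> \<beta> \<in> \<Phi> \<Longrightarrow> \<beta> \<in> span {\<alpha>} \<Longrightarrow> \<beta> = \<alpha> \<or> \<beta> = - \<alpha>"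
  and reflection_root: "\<alpha> \<in> \<Phi> \<Longrightarrow> \<beta> \<in> \<Phi> \<Longrightarrow> reflection \<alpha> 0 \<beta> \<in> \<Phi>"
  using root_system unfolding root_system_def by blast+

lemma simple_roots: "\<Delta> \<subseteq> \<Phi>" and independent_simple: "independent \<Delta>"
  and root_cases: "\<beta> \<in> \<Phi> \<Longrightarrow> \<beta> \<in> K \<or> - \<beta> \<in> K"
  using simple_system unfolding simple_system_def by blast+

lemma finite_\<Delta>: "finite \<Delta>"
  using simple_roots finite_\<Phi> finite_subset by blast

lemma uminus_root: "\<alpha> \<in> \<Phi> \<Longrightarrow> - \<alpha> \<in> \<Phi>"
  using root_system unfolding root_system_def by blast

lemma independent_coeffs:
  "(\<Sum>\<alpha>\<in>\<Delta>. c \<alpha> *\<^sub>R \<alpha>) = 0 \<Longrightarrow> \<alpha> \<in> \<Delta> \<Longrightarrow> c \<alpha> = 0"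
  using independentD[OF independent_simple finite_\<Delta> subset_refl] by blast

lemma simple_in_K: "\<alpha> \<in> \<Delta> \<Longrightarrow> \<alpha> \<in> K"
  using finite_\<Delta>
  by (intro nonneg_combinationsI[of _ "\<lambda>\<beta>. if \<beta> = \<alpha> then 1 else 0"])
     (simp_all add: if_distrib[of "\<lambda>c. c *\<^sub>R _"] cong: if_cong)

lemma K_pointed:
  assumes "v \<in> K" "- v \<in> K"
  shows "v = 0"
proof -
  obtain c where c: "v = (\<Sum>\<alpha>\<in>\<Delta>. c \<alpha> *\<^sub>R \<alpha>)" "\<And>\<alpha>. \<alpha> \<in> \<Delta> \<Longrightarrow> 0 \<le> c \<alpha>"
    using nonneg_combinationsE[OF assms(1)] by blast
  obtain d where d: "- v = (\<Sum>\<alpha>\<in>\<Delta>. d \<alpha> *\<^sub>R \<alpha>)" "\<And>\<alpha>. \<alpha> \<in> \<Delta> \<Longrightarrow> 0 \<le> d \<alpha>"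
    using nonneg_combinationsE[OF assms(2)] by blast
  have "(\<Sum>\<alpha>\<in>\<Delta>. (c \<alpha> + d \<alpha>) *\<^sub>R \<alpha>) = 0"
    by (simp add: scaleR_add_left sum.distrib flip: c(1) d(1))
  then have "c \<alpha> = 0" if "\<alpha> \<in> \<Delta>" for \<alpha>
    using independent_coeffs[of "\<lambda>\<alpha>. c \<alpha> + d \<alpha>" \<alpha>] c(2)[OF that] d(2)[OF that] that by simp
  then show ?thesis using c(1) by simp
qed

lemma root_not_both: "\<beta> \<in> \<Phi> \<Longrightarrow> \<beta> \<in> K \<Longrightarrow> - \<beta> \<notin> K"
  using K_pointed zero_notin by blast

text \<open>The reflection changes only the coefficient of \<open>\<alpha>\<close>. If the image
  were negative, all other coefficients of \<open>\<beta>\<close> would be both nonnegative and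
  nonpositive, so \<open>\<beta>\<close> would be a multiple of \<open>\<alpha>\<close>, hence
  \<open>\<alpha>\<close> or \<open>- \<alpha>\<close>.\<close>

lemma reflection_positive:
  assumes \<alpha>: "\<alpha> \<in> \<Delta>" and \<beta>: "\<beta> \<in> \<Phi>" "\<beta> \<in> K" "\<beta> \<noteq> \<alpha>"
  shows "reflection \<alpha> 0 \<beta> \<in> K"
proof (rule ccontr)
  assume "reflection \<alpha> 0 \<beta> \<notin> K"
  then have neg: "- reflection \<alpha> 0 \<beta> \<in> K"
    using root_cases reflection_root simple_roots \<alpha> \<beta>(1) by blast
  obtain c where c: "\<beta> = (\<Sum>\<gamma>\<in>\<Delta>. c \<gamma> *\<^sub>R \<gamma>)" "\<And>\<gamma>. \<gamma> \<in> \<Delta> \<Longrightarrow> 0 \<le> c \<gamma>"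
    using nonneg_combinationsE[OF \<beta>(2)] by blast
  obtain d where d: "- reflection \<alpha> 0 \<beta> = (\<Sum>\<gamma>\<in>\<Delta>. d \<gamma> *\<^sub>R \<gamma>)" "\<And>\<gamma>. \<gamma> \<in> \<Delta> \<Longrightarrow> 0 \<le> d \<gamma>"
    using nonneg_combinationsE[OF neg] by blast
  define k where "k = (\<alpha> \<bullet> \<beta>) * (2 / (\<alpha> \<bullet> \<alpha>))"
  have refl: "reflection \<alpha> 0 \<beta> = \<beta> - k *\<^sub>R \<alpha>"
    by (simp add: reflection_def coroot_def k_def)
  have "(\<Sum>\<gamma>\<in>\<Delta>. (c \<gamma> + d \<gamma> - (if \<gamma> = \<alpha> then k else 0)) *\<^sub>R \<gamma>) = \<beta> + - reflection \<alpha> 0 \<beta> - k *\<^sub>R \<alpha>"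
    using \<alpha> finite_\<Delta>
    by (simp add: scaleR_add_left scaleR_diff_left sum.distrib sum_subtractf
        if_distrib[of "\<lambda>c. c *\<^sub>R _"] flip: c(1) d(1) cong: if_cong)
  also have "\<dots> = 0" by (simp add: refl)
  finally have "c \<gamma> + d \<gamma> = 0" if "\<gamma> \<in> \<Delta>" "\<gamma> \<noteq> \<alpha>" for \<gamma>
    using that independent_coeffs[of "\<lambda>\<gamma>. c \<gamma> + d \<gamma> - (if \<gamma> = \<alpha> then k else 0)" \<gamma>] by simp
  then have "c \<gamma> = 0" if "\<gamma> \<in> \<Delta>" "\<gamma> \<noteq> \<alpha>" for \<gamma>
    using that c(2)[of \<gamma>] d(2)[of \<gamma>] by force
  then have "\<beta> = c \<alpha> *\<^sub>R \<alpha>"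
    using \<alpha> finite_\<Delta> by (subst c(1)) (simp add: sum.remove)
  then have "\<beta> \<in> span {\<alpha>}" by (simp add: span_base span_scale)
  then have "\<beta> = - \<alpha>" using multiples[of \<alpha> \<beta>] \<alpha> \<beta> simple_roots by blast
  then show False using \<alpha> \<beta>(2) simple_in_K root_not_both simple_roots by blast
qed

lemma positive_on_chamber:
  assumes "\<beta> \<in> \<Phi>" "\<beta> \<in> K" and x: "\<And>\<alpha>. \<alpha> \<in> \<Delta> \<Longrightarrow> 0 < \<alpha> \<bullet> x"
  shows "0 < \<beta> \<bullet> x"
proof -
  obtain c where c: "\<beta> = (\<Sum>\<alpha>\<in>\<Delta>. c \<alpha> *\<^sub>R \<alpha>)" "\<And>\<alpha>. \<alpha> \<in> \<Delta> \<Longrightarrow> 0 \<le> c \<alpha>"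
    using nonneg_combinationsE[OF assms(2)] by blast
  have "\<exists>\<alpha>\<in>\<Delta>. c \<alpha> \<noteq> 0"
  proof (rule ccontr)
    assume "\<not> (\<exists>\<alpha>\<in>\<Delta>. c \<alpha> \<noteq> 0)"
    then have "\<beta> = 0" by (subst c(1)) simp
    then show False using assms(1) zero_notin by blast
  qed
  then obtain \<alpha> where \<alpha>: "\<alpha> \<in> \<Delta>" "0 < c \<alpha>" using c(2) by force
  have "0 < (\<Sum>\<alpha>\<in>\<Delta>. c \<alpha> * (\<alpha> \<bullet> x))"
    using \<alpha> x c(2) by (intro sum_pos2[OF finite_\<Delta>, of \<alpha>]) (auto simp: less_imp_le)
  then show ?thesis by (subst c(1)) (simp add: inner_sum_left)
qed

lemma positive_roots_iff: "\<beta> \<in> positive_roots \<Phi> \<Delta> \<longleftrightarrow> \<beta> \<in> \<Phi> \<and> \<beta> \<in> K"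
  by (simp add: positive_roots_def)

lemma finite_setting:
  "reflection_setting (weyl_group \<Phi>) (positive_roots \<Phi> \<Delta> \<times> {0}) (\<Delta> \<times> {0}) {x. \<forall>\<alpha>\<in>\<Delta>. 0 < \<alpha> \<bullet> x}"
proof
  let ?S = "{reflection \<alpha> 0 | \<alpha>. \<alpha> \<in> \<Phi>}"
  have nz: "\<alpha> \<noteq> 0" if "\<alpha> \<in> \<Phi>" for \<alpha> using that zero_notin by blast
  show "id \<in> weyl_group \<Phi>" by (simp add: weyl_group_def generated_by.id)
  show "g \<circ> h \<in> weyl_group \<Phi>" if "g \<in> weyl_group \<Phi>" "h \<in> weyl_group \<Phi>" for g h
    using that by (simp add: weyl_group_def generated_by_comp)
  show "\<exists>h\<in>weyl_group \<Phi>. h \<circ> g = id \<and> g \<circ> h = id" if "g \<in> weyl_group \<Phi>" for g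
    using that unfolding weyl_group_def
    by (intro generated_by_inverse) (auto simp: fun_eq_iff reflection_involution nz)
  show "orthogonal_transformation (linear_part g)" if "g \<in> weyl_group \<Phi>" for g
    using that nz unfolding weyl_group_def
    by (intro generated_by_reflections_orthogonal[of ?S]) blast+
  show "finite (\<Delta> \<times> {0 :: real})" using finite_\<Delta> by simp
  show "\<Delta> \<times> {0} \<subseteq> positive_roots \<Phi> \<Delta> \<times> {0 :: real}"
    using simple_roots simple_in_K by (auto simp: positive_roots_iff)
  show "fst r \<noteq> 0" if "r \<in> \<Delta> \<times> {0 :: real}" for r
    using that simple_roots nz by auto
  show "countable (positive_roots \<Phi> \<Delta> \<times> {0 :: real})"
    using finite_\<Phi> by (intro countable_finite) (auto simp: positive_roots_def)
  show "root_reflection r \<in> weyl_group \<Phi>" if "r \<in> \<Delta> \<times> {0}" for r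
    using that simple_roots unfolding weyl_group_def root_reflection_def
    by (intro generated_by_generator) auto
  show "- r \<notin> positive_roots \<Phi> \<Delta> \<times> {0 :: real}" if "r \<in> positive_roots \<Phi> \<Delta> \<times> {0}" for r
    using that root_not_both by (auto simp: positive_roots_iff)
  show "root_action (root_reflection r) s \<in> positive_roots \<Phi> \<Delta> \<times> {0}"
    if r: "r \<in> \<Delta> \<times> {0}" and s: "s \<in> positive_roots \<Phi> \<Delta> \<times> {0}" and ne: "s \<noteq> r" for r s
  proof -
    obtain \<alpha> \<beta> where [simp]: "r = (\<alpha>, 0)" "s = (\<beta>, 0)" using r s by auto
    have "\<alpha> \<in> \<Delta>" "\<alpha> \<in> \<Phi>" "\<beta> \<in> \<Phi>" "\<beta> \<in> K" "\<beta> \<noteq> \<alpha>"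
      using r s ne simple_roots by (auto simp: positive_roots_iff)
    then show ?thesis
      by (simp add: root_reflection_def root_action_reflection nz positive_roots_iff
          reflection_root reflection_positive)
  qed
  show "{x. \<forall>\<alpha>\<in>\<Delta>. 0 < \<alpha> \<bullet> x} = {x. \<forall>r\<in>\<Delta> \<times> {0}. 0 < root_eval r x}"
    by (simp add: root_eval_def)
  show "0 < root_eval r x"
    if "r \<in> positive_roots \<Phi> \<Delta> \<times> {0}" "x \<in> {x. \<forall>\<alpha>\<in>\<Delta>. 0 < \<alpha> \<bullet> x}" for r x
    using that positive_on_chamber by (auto simp: root_eval_def positive_roots_iff)
qed

end

section \<open>The highest root and the affine simple reflection\<close>

locale highest_root_system = based_root_system \<Phi> \<Delta> for \<Phi> \<Delta> :: "(real^'n) set" +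
  fixes \<theta> :: "real^'n"
  assumes crystallographic: "crystallographic \<Phi>" and highest_root: "highest_root \<Phi> \<Delta> \<theta>"
begin

lemma \<theta>_root: "\<theta> \<in> \<Phi>" and \<theta>_K: "\<theta> \<in> K" and \<theta>_highest: "\<beta> \<in> \<Phi> \<Longrightarrow> \<theta> - \<beta> \<in> K"
  using highest_root by (auto simp: highest_root_def positive_roots_iff)

lemma integer_pairing: "\<alpha> \<in> \<Phi> \<Longrightarrow> \<beta> \<in> \<Phi> \<Longrightarrow> \<alpha> \<bullet> coroot \<beta> \<in> \<int>"
  using crystallographic by (auto simp: crystallographic_def)

lemma reflection_eq: "reflection \<alpha> 0 \<beta> = \<beta> - (\<beta> \<bullet> coroot \<alpha>) *\<^sub>R \<alpha>"
  by (simp add: reflection_def coroot_def inner_commute)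

text \<open>With a negative inner product, reflecting in \<open>\<alpha>\<close> would add a
  positive multiple of \<open>\<alpha>\<close> to \<open>\<theta>\<close> and give a root that is
  not below \<open>\<theta>\<close>.\<close>

lemma \<theta>_dominant:
  assumes "\<alpha> \<in> \<Delta>"
  shows "0 \<le> \<alpha> \<bullet> \<theta>"
proof (rule ccontr)
  let ?k = "\<theta> \<bullet> coroot \<alpha>"
  assume *: "\<not> 0 \<le> \<alpha> \<bullet> \<theta>"
  have \<alpha>: "\<alpha> \<in> \<Phi>" "\<alpha> \<noteq> 0" using assms simple_roots zero_notin by auto
  then have k: "?k < 0" using * by (simp add: coroot_def inner_commute divide_neg_pos)
  have "\<theta> - reflection \<alpha> 0 \<theta> \<in> K"
    using \<theta>_highest reflection_root \<theta>_root \<alpha> by blast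
  then have "?k *\<^sub>R \<alpha> \<in> K" by (simp add: reflection_eq)
  then have "(1 / - ?k) *\<^sub>R (?k *\<^sub>R \<alpha>) \<in> K"
    by (rule nonneg_combinations_scale) (use k in simp)
  also have "(1 / - ?k) *\<^sub>R (?k *\<^sub>R \<alpha>) = - \<alpha>"
    unfolding scaleR_scaleR using k by (simp del: scaleR_eq_0_iff)
  finally have "- \<alpha> \<in> K" .
  then show False using assms \<alpha> simple_in_K root_not_both by blast
qed

lemma pairing_\<theta>_nonneg:
  assumes "\<beta> \<in> K"
  shows "0 \<le> \<beta> \<bullet> coroot \<theta>"
  using nonneg_combinations_inner[OF assms \<theta>_dominant] by (simp add: coroot_def)

text \<open>The reflected root is \<open>\<beta>\<close> plus at least twice
  \<open>\<theta>\<close>. That it lies below \<open>\<theta>\<close> makes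
  \<open>\<beta> + \<theta>\<close> nonpositive, while \<open>- \<beta>\<close> lying below
  \<open>\<theta>\<close> makes it nonnegative; the cone is pointed.\<close>

lemma pairing_\<theta>_small:
  assumes "\<beta> \<in> \<Phi>" "\<beta> \<bullet> coroot \<theta> \<le> - 2"
  shows "\<beta> = - \<theta>"
proof -
  let ?k = "- (\<beta> \<bullet> coroot \<theta>)"
  have "\<theta> - reflection \<theta> 0 \<beta> \<in> K"
    using \<theta>_highest reflection_root \<theta>_root assms by blast
  moreover have "(?k - 2) *\<^sub>R \<theta> \<in> K"
    using assms \<theta>_K by (intro nonneg_combinations_scale) auto
  ultimately have "(\<theta> - reflection \<theta> 0 \<beta>) + (?k - 2) *\<^sub>R \<theta> \<in> K"
    by (rule nonneg_combinations_add)
  also have "(\<theta> - reflection \<theta> 0 \<beta>) + (?k - 2) *\<^sub>R \<theta> = - (\<theta> - (- \<beta>))"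
    by (simp add: reflection_eq algebra_simps scaleR_2)
  finally have "\<theta> - (- \<beta>) = 0"
    using K_pointed[of "\<theta> - (- \<beta>)"] \<theta>_highest uminus_root assms(1) by blast
  then show ?thesis by (simp add: eq_neg_iff_add_eq_0 add.commute)
qed

lemma affine_positive_iff:
  "(\<beta>, n) \<in> affine_positive_roots \<Phi> \<Delta> \<longleftrightarrow> \<beta> \<in> \<Phi> \<and> n \<in> \<int> \<and> (n = 0 \<and> \<beta> \<in> K \<or> n \<le> - 1)"
  by (auto simp: affine_positive_roots_def positive_roots_iff)

lemma Ints_less_one: "k \<in> \<int> \<Longrightarrow> (k::real) < n \<Longrightarrow> n \<in> \<int> \<Longrightarrow> k \<le> n - 1"
  by (auto elim!: Ints_cases)

text \<open>The pairing of \<open>\<beta>\<close> with the coroot of \<open>\<theta>\<close> is an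
  integer k, and the level becomes n - k. Levels of positive roots are at most 0, so k >= 1 is
  immediate; a negative k excludes positive \<open>\<beta>\<close>, and k <= -2 leaves only
  \<open>- \<theta>\<close>.\<close>

lemma affine_reflection_\<theta>:
  assumes s: "(\<beta>, n) \<in> affine_positive_roots \<Phi> \<Delta>" and ne: "(\<beta>, n) \<noteq> (- \<theta>, - 1)"
  shows "(reflection \<theta> 0 \<beta>, n - \<beta> \<bullet> coroot \<theta>) \<in> affine_positive_roots \<Phi> \<Delta>"
proof -
  let ?k = "\<beta> \<bullet> coroot \<theta>"
  have \<beta>: "\<beta> \<in> \<Phi>" and n: "n \<in> \<int>" "n = 0 \<and> \<beta> \<in> K \<or> n \<le> - 1"
    using s by (auto simp: affine_positive_iff)
  have k: "?k \<in> \<int>" using integer_pairing \<beta> \<theta>_root by blast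
  have "n - ?k = 0 \<and> reflection \<theta> 0 \<beta> \<in> K \<or> n - ?k \<le> - 1"
  proof (cases "0 \<le> ?k")
    case True
    then consider "?k = 0" | "1 \<le> ?k" using Ints_less_one[of 0 ?k] k by fastforce
    then show ?thesis
    proof cases
      case 1
      then show ?thesis using n by (auto simp: reflection_eq)
    next
      case 2
      then show ?thesis using n by auto
    qed
  next
    case False
    then have "\<beta> \<notin> K" using pairing_\<theta>_nonneg by blast
    then have n1: "n \<le> - 1" using n by blast
    have "?k \<le> - 1" using Ints_less_one[of ?k 0] k False by auto
    then consider "?k = - 1" | "?k \<le> - 2" using Ints_less_one[of ?k "-1"] k by fastforce
    then show ?thesis
    proof cases
      case 1
      \<comment> \<open>Needed when n = -1: the new level is 0, where the vector part itself must be
        positive.\<close>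
      have "reflection \<theta> 0 \<beta> = \<theta> - (- \<beta>)" by (simp add: reflection_eq 1)
      then have "reflection \<theta> 0 \<beta> \<in> K" using \<theta>_highest uminus_root \<beta> by metis
      moreover have "n = - 1 \<or> n \<le> - 2" using Ints_less_one[of n "-1"] n1 n(1) by fastforce
      ultimately show ?thesis using 1 by auto
    next
      case 2
      then have \<beta>\<theta>: "\<beta> = - \<theta>" using pairing_\<theta>_small \<beta> by blast
      have "\<theta> \<noteq> 0" using \<theta>_root zero_notin by blast
      then have k2: "?k = - 2" by (simp add: \<beta>\<theta> inner_coroot_self)
      \<comment> \<open>For n = -1 the image would be \<open>(\<theta>, 1)\<close>, which is not
        positive. At n = -2 it is \<open>(\<theta>, 0)\<close>.\<close>
      have "n \<noteq> - 1" using ne \<beta>\<theta> by blast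
      then have "n \<le> - 2" using Ints_less_one[of n "-1"] n1 n(1) by fastforce
      then have "n = - 2 \<or> n \<le> - 3" using Ints_less_one[of n "-2"] n(1) by fastforce
      moreover have "reflection \<theta> 0 \<beta> = \<theta>"
        unfolding reflection_eq k2 by (simp add: \<beta>\<theta> scaleR_2)
      ultimately show ?thesis using k2 \<theta>_K by auto
    qed
  qed
  then show ?thesis
    using reflection_root \<beta> \<theta>_root n k by (simp add: affine_positive_iff)
qed

lemma affine_setting:
  "reflection_setting (affine_weyl_group \<Phi> \<Delta>) (affine_positive_roots \<Phi> \<Delta>) (affine_simple_roots \<Delta> \<theta>)
    {x. \<forall>r\<in>affine_simple_roots \<Delta> \<theta>. 0 < root_eval r x}"
proof
  let ?S = "{reflection \<alpha> n | \<alpha> n. \<alpha> \<in> positive_roots \<Phi> \<Delta> \<and> n \<in> \<int>}"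
  have nz: "\<alpha> \<noteq> 0" if "\<alpha> \<in> \<Phi>" for \<alpha> using that zero_notin by blast
  have nz': "\<alpha> \<noteq> 0" if "\<alpha> \<in> positive_roots \<Phi> \<Delta>" for \<alpha> using that nz positive_roots_iff by blast
  show "id \<in> affine_weyl_group \<Phi> \<Delta>" by (simp add: affine_weyl_group_def generated_by.id)
  show "g \<circ> h \<in> affine_weyl_group \<Phi> \<Delta>"
    if "g \<in> affine_weyl_group \<Phi> \<Delta>" "h \<in> affine_weyl_group \<Phi> \<Delta>" for g h
    using that by (simp add: affine_weyl_group_def generated_by_comp)
  show "\<exists>h\<in>affine_weyl_group \<Phi> \<Delta>. h \<circ> g = id \<and> g \<circ> h = id" if "g \<in> affine_weyl_group \<Phi> \<Delta>" for g
    using that unfolding affine_weyl_group_def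
    by (intro generated_by_inverse) (auto simp: fun_eq_iff reflection_involution nz')
  show "orthogonal_transformation (linear_part g)" if "g \<in> affine_weyl_group \<Phi> \<Delta>" for g
    using that nz' unfolding affine_weyl_group_def
    by (intro generated_by_reflections_orthogonal[of ?S]) blast+
  show "finite (affine_simple_roots \<Delta> \<theta>)" using finite_\<Delta> by (simp add: affine_simple_roots_def)
  show "affine_simple_roots \<Delta> \<theta> \<subseteq> affine_positive_roots \<Phi> \<Delta>"
    using simple_roots simple_in_K \<theta>_root uminus_root
    by (auto simp: affine_positive_iff affine_simple_roots_def)
  show "fst r \<noteq> 0" if "r \<in> affine_simple_roots \<Delta> \<theta>" for r
    using that simple_roots nz \<theta>_root by (auto simp: affine_simple_roots_def)
  have "countable (\<int> :: real set)" by (simp add: Ints_def)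
  then have "countable (\<Phi> \<times> (\<int> :: real set))"
    by (rule countable_SIGMA[OF countable_finite[OF finite_\<Phi>]])
  then show "countable (affine_positive_roots \<Phi> \<Delta>)"
    by (rule countable_subset[rotated]) (auto simp: affine_positive_roots_def)
  show "root_reflection r \<in> affine_weyl_group \<Phi> \<Delta>" if r: "r \<in> affine_simple_roots \<Delta> \<theta>" for r
    unfolding affine_weyl_group_def
  proof (rule generated_by_generator)
    have "root_reflection (- \<theta>, - 1) = reflection \<theta> 1"
      using reflection_uminus[of \<theta> 1] by (simp add: root_reflection_def)
    moreover have "reflection \<theta> 1 \<in> ?S"
      using \<theta>_root \<theta>_K Ints_1 unfolding positive_roots_iff by blast
    moreover have "root_reflection (\<alpha>, 0) \<in> ?S" if "\<alpha> \<in> \<Delta>" for \<alpha>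
      using that simple_roots simple_in_K Ints_0
      unfolding positive_roots_iff root_reflection_def fst_conv snd_conv by blast
    ultimately show "root_reflection r \<in> ?S"
      using r unfolding affine_simple_roots_def by fastforce
  qed
  show "- r \<notin> affine_positive_roots \<Phi> \<Delta>" if "r \<in> affine_positive_roots \<Phi> \<Delta>" for r
    using that root_not_both by (cases r) (auto simp: affine_positive_iff)
  show "root_action (root_reflection r) s \<in> affine_positive_roots \<Phi> \<Delta>"
    if r: "r \<in> affine_simple_roots \<Delta> \<theta>" and s: "s \<in> affine_positive_roots \<Phi> \<Delta>" and ne: "s \<noteq> r" for r s
  proof -
    obtain \<beta> n where [simp]: "s = (\<beta>, n)" by (cases s)
    consider \<alpha> where "\<alpha> \<in> \<Delta>" "r = (\<alpha>, 0)" | "r = (- \<theta>, - 1)"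
      using r by (auto simp: affine_simple_roots_def)
    then show ?thesis
    proof cases
      case 1
      then have "\<alpha> \<in> \<Phi>" using simple_roots by blast
      then show ?thesis
        using 1 s ne reflection_root reflection_positive[of \<alpha> \<beta>]
        by (auto simp: root_reflection_def root_action_reflection nz affine_positive_iff)
    next
      case 2
      have "root_reflection r = reflection \<theta> 1"
        using reflection_uminus[of \<theta> 1] by (simp add: root_reflection_def 2)
      then show ?thesis
        using affine_reflection_\<theta>[of \<beta> n] s ne 2 \<theta>_root
        by (simp add: root_action_reflection nz)
    qed
  qed
  show "0 < root_eval r x"
    if r: "r \<in> affine_positive_roots \<Phi> \<Delta>" and x: "x \<in> {x. \<forall>r\<in>affine_simple_roots \<Delta> \<theta>. 0 < root_eval r x}"
    for r x
  proof -
    obtain \<beta> n where [simp]: "r = (\<beta>, n)" by (cases r)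
    have \<beta>: "\<beta> \<in> \<Phi>" "n = 0 \<and> \<beta> \<in> K \<or> n \<le> - 1" using r by (auto simp: affine_positive_iff)
    have x1: "0 < \<alpha> \<bullet> x" if "\<alpha> \<in> \<Delta>" for \<alpha>
      using x that by (auto simp: affine_simple_roots_def root_eval_def)
    have x2: "\<theta> \<bullet> x < 1" using x by (auto simp: affine_simple_roots_def root_eval_def)
    \<comment> \<open>This bounds \<open>\<beta>\<close> from below on the alcove by the value of
      \<open>- \<theta>\<close>, which exceeds -1; so every root of level at most -1 is positive
      there.\<close>
    have "\<theta> - (- \<beta>) \<in> K" using \<theta>_highest uminus_root \<beta> by blast
    then have "0 \<le> (\<theta> - (- \<beta>)) \<bullet> x" by (rule nonneg_combinations_inner) (simp add: x1 less_imp_le)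
    then show ?thesis
      using \<beta> x1 x2 positive_on_chamber[of \<beta> x] by (auto simp: root_eval_def inner_add_left)
  qed
qed simp

end

section \<open>Exit times of continuous paths\<close>

lemma continuous_on_root_eval:
  "continuous_on S y \<Longrightarrow> continuous_on S (\<lambda>u. root_eval r (y u))"
  by (cases r) (auto simp: root_eval_def intro!: continuous_intros)

lemma root_eval_measurable [measurable]: "root_eval r \<in> borel_measurable borel"
  by (intro borel_measurable_continuous_onI continuous_on_root_eval continuous_on_id)

lemma ex_ennreal_add_less:
  assumes "0 \<le> t" "ennreal t < T"
  shows "\<exists>k. ennreal (t + inverse (real (Suc k))) < T"
proof (cases T)
  case (real s)
  then have "0 < s - t" using assms by (simp add: ennreal_less_iff)
  then obtain k where "inverse (real (Suc k)) < s - t" using reals_Archimedean by blast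
  then have "t + inverse (real (Suc k)) < s" by simp
  then have "ennreal (t + inverse (real (Suc k))) < T"
    unfolding real(2) using assms(1) by (subst ennreal_less_iff) auto
  then show ?thesis ..
qed simp

lemma hitting_time_le: "0 \<le> u \<Longrightarrow> root_eval r (X u \<omega>) = 0 \<Longrightarrow> hitting_time X r \<omega> \<le> ennreal u"
  unfolding hitting_time_def by (rule Inf_lower) auto

lemma hitting_time_ge:
  "(\<And>u. 0 \<le> u \<Longrightarrow> root_eval r (X u \<omega>) = 0 \<Longrightarrow> c \<le> ennreal u) \<Longrightarrow> c \<le> hitting_time X r \<omega>"
  unfolding hitting_time_def by (rule Inf_greatest) auto

lemma set_hitting_time_le: "r \<in> A \<Longrightarrow> set_hitting_time X A \<omega> \<le> hitting_time X r \<omega>"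
  unfolding set_hitting_time_def by (rule INF_lower)

lemma continuous_bounded_below:
  fixes f :: "real \<Rightarrow> real"
  assumes "continuous_on {a..b} f" "a \<le> b" "\<And>u. u \<in> {a..b} \<Longrightarrow> 0 < f u"
  shows "\<exists>c>0. \<forall>u\<in>{a..b}. c \<le> f u"
proof -
  obtain z where "z \<in> {a..b}" "\<And>u. u \<in> {a..b} \<Longrightarrow> f z \<le> f u"
    using continuous_attains_inf[of "{a..b}" f] assms by auto
  then show ?thesis using assms(3) by blast
qed

text \<open>For a path in the time interval from \<open>v\<close> on, shifted to start at time 0: it stays away from
  the hyperplanes of \<open>A\<close> until shortly after time \<open>t\<close>. Only rational times occur, so that this is
  a measurable condition on arbitrary paths.\<close>

definition avoids :: "'n::finite root set \<Rightarrow> real \<Rightarrow> real \<Rightarrow> (real \<Rightarrow> real^'n) \<Rightarrow> bool" where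
  "avoids A t v \<gamma> \<longleftrightarrow> (\<exists>k. \<forall>r\<in>A. \<exists>n. \<forall>q::rat.
     0 \<le> real_of_rat q \<longrightarrow> v + real_of_rat q \<le> t + inverse (real (Suc k)) \<longrightarrow>
     inverse (real (Suc n)) \<le> \<bar>root_eval r (\<gamma> (real_of_rat q))\<bar>)"

text \<open>The rational time 0 lies in the window because \<open>v\<close> is at most
  \<open>t\<close>, and the bound fails there for every n.\<close>

lemma not_avoids:
  assumes "r \<in> A" "root_eval r (\<gamma> 0) = 0" "v \<le> t"
  shows "\<not> avoids A t v \<gamma>"
proof
  assume "avoids A t v \<gamma>"
  then obtain k n where
    *: "\<And>q::rat. 0 \<le> real_of_rat q \<Longrightarrow> v + real_of_rat q \<le> t + inverse (real (Suc k)) \<Longrightarrow>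
     inverse (real (Suc n)) \<le> \<bar>root_eval r (\<gamma> (real_of_rat q))\<bar>"
    using assms(1) unfolding avoids_def by blast
  have "v \<le> t + inverse (real (Suc k))"
    using assms(3) by (meson add_increasing2 inverse_nonnegative_iff_nonnegative of_nat_0_le_iff)
  then have "inverse (real (Suc n)) \<le> 0"
    using *[of 0] assms(2) by simp
  then show False by simp
qed

section \<open>Leaving \<open>F\<close>, detected at rational times\<close>

context reflection_setting
begin

lemma open_F: "open F"
proof -
  have "F = (\<Inter>r\<in>simple. {x. 0 < root_eval r x})" by (auto simp: F_eq)
  then show ?thesis
    using finite_simple
    by (auto intro!: open_INT open_Collect_less continuous_on_root_eval continuous_intros)
qed

text \<open>Compactness of the time interval gives a bound for each simple root, and finiteness of
  \<open>simple\<close> a common one.\<close>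

lemma inside_F_bound:
  assumes "continuous_on {0..b} y" "0 \<le> (b::real)" "\<And>u. u \<in> {0..b} \<Longrightarrow> y u \<in> F"
  shows "\<exists>n. \<forall>r\<in>simple. \<forall>u\<in>{0..b}. inverse (real (Suc n)) \<le> root_eval r (y u)"
proof -
  have "\<forall>\<^sub>F n in sequentially. \<forall>u\<in>{0..b}. inverse (real (Suc n)) \<le> root_eval r (y u)"
    if "r \<in> simple" for r
  proof -
    have "0 < root_eval r (y u)" if "u \<in> {0..b}" for u
      using assms(3)[OF that] \<open>r \<in> simple\<close> by (simp add: F_eq)
    then have "\<exists>c>0. \<forall>u\<in>{0..b}. c \<le> root_eval r (y u)"
      by (rule continuous_bounded_below[OF continuous_on_root_eval[OF assms(1)] assms(2)])
    then obtain c where c: "c > 0" "\<And>u. u \<in> {0..b} \<Longrightarrow> c \<le> root_eval r (y u)"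
      by blast
    have "\<forall>\<^sub>F n in sequentially. inverse (real (Suc n)) < c"
      using LIMSEQ_inverse_real_of_nat c(1) by (rule order_tendstoD)
    then show ?thesis by eventually_elim (use c(2) in force)
  qed
  then have "\<forall>\<^sub>F n in sequentially. \<forall>r\<in>simple. \<forall>u\<in>{0..b}. inverse (real (Suc n)) \<le> root_eval r (y u)"
    using finite_simple by (simp add: eventually_ball_finite_distrib)
  then show ?thesis by (rule eventually_happens'[OF sequentially_bot])
qed

text \<open>\<open>reached n y u\<close> says that some simple root is smaller than \<open>1/(n+1)\<close> at some rational time
  before \<open>u\<close>, that is \<open>\<sigma>\<^sub>n < u\<close> for the first such time \<open>\<sigma>\<^sub>n\<close>. For a continuous path starting in
  \<open>F\<close> the exit time is the limit of the strictly increasing \<open>\<sigma>\<^sub>n\<close>. That \<open>\<sigma>\<^sub>n\<close> does not become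
  constant is part of \<open>stopped\<close>: this makes \<open>stopped y\<close> closed in time for every path, continuous
  or not, so that the exit time is a stopping time of the natural filtration itself, without
  completing it or passing to right limits.\<close>

definition reached :: "nat \<Rightarrow> (real \<Rightarrow> real^'n) \<Rightarrow> real \<Rightarrow> bool" where
  "reached n y u \<longleftrightarrow> (\<exists>q::rat. 0 \<le> real_of_rat q \<and> real_of_rat q < u \<and>
     (\<exists>r\<in>simple. root_eval r (y (real_of_rat q)) < inverse (real (Suc n))))"

definition stopped :: "(real \<Rightarrow> real^'n) \<Rightarrow> real \<Rightarrow> bool" where
  "stopped y u \<longleftrightarrow> (\<forall>n. reached n y u) \<and>
     (\<forall>n. \<exists>k. \<exists>r::rat. 0 \<le> real_of_rat r \<and> real_of_rat r < u \<and>
        reached n y (real_of_rat r) \<and> \<not> reached k y (real_of_rat r))"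

definition exit_time :: "(real \<Rightarrow> real^'n) \<Rightarrow> ennreal" where
  "exit_time y = Inf {ennreal u | u. 0 \<le> u \<and> stopped y u}"

lemma reached_mono: "reached n y u \<Longrightarrow> u \<le> v \<Longrightarrow> reached n y v"
  unfolding reached_def by (meson less_le_trans)

lemma stopped_mono: "stopped y u \<Longrightarrow> u \<le> v \<Longrightarrow> stopped y v"
  unfolding stopped_def using reached_mono by (meson less_le_trans)

text \<open>An infimum yields only \<open>stopped\<close> at all later times. The second clause of
  \<open>stopped\<close> recovers time \<open>u\<close> itself: its rational witnesses are not
  stopped, hence lie at or before \<open>u\<close>.\<close>

lemma exit_time_le_iff:
  assumes "0 \<le> u"
  shows "exit_time y \<le> ennreal u \<longleftrightarrow> stopped y u"
proof
  assume "stopped y u"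
  then show "exit_time y \<le> ennreal u"
    unfolding exit_time_def using assms by (intro Inf_lower) auto
next
  assume le: "exit_time y \<le> ennreal u"
  have above: "stopped y w" if "u < w" for w
  proof -
    have "exit_time y < ennreal w" using le that assms by (simp add: le_less_trans ennreal_less_iff)
    then obtain w' where "0 \<le> w'" "stopped y w'" "ennreal w' < ennreal w"
      unfolding exit_time_def by (auto simp: Inf_less_iff)
    then show ?thesis using stopped_mono[of y w' w] by (simp add: ennreal_less_iff)
  qed
  have *: "\<exists>k. \<exists>r::rat. 0 \<le> real_of_rat r \<and> real_of_rat r \<le> u \<and>
        reached n y (real_of_rat r) \<and> \<not> reached k y (real_of_rat r)" for n
  proof -
    have "stopped y (u + 1)" by (rule above) simp
    then obtain k and r :: rat where r: "0 \<le> real_of_rat r" "reached n y (real_of_rat r)"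
      "\<not> reached k y (real_of_rat r)"
      unfolding stopped_def by metis
    then have "\<not> stopped y (real_of_rat r)" by (auto simp: stopped_def)
    then have "real_of_rat r \<le> u" using above not_le by blast
    then show ?thesis using r by blast
  qed
  then have all: "reached n y u" for n using reached_mono by meson
  show "stopped y u"
    unfolding stopped_def
  proof (intro conjI allI)
    fix n
    show "reached n y u" by (rule all)
    obtain k and r :: rat where r: "0 \<le> real_of_rat r" "real_of_rat r \<le> u"
        "reached n y (real_of_rat r)" "\<not> reached k y (real_of_rat r)" using * by blast
    \<comment> \<open>At \<open>u\<close> every level has been reached, but at the witness level
      \<open>k\<close> has not.\<close>
    then have "real_of_rat r \<noteq> u" using all by metis
    then show "\<exists>k. \<exists>r::rat. 0 \<le> real_of_rat r \<and> real_of_rat r < u \<and>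
        reached n y (real_of_rat r) \<and> \<not> reached k y (real_of_rat r)"
      using r by (metis order_le_less)
  qed
qed

context
  fixes y :: "real \<Rightarrow> real^'n"
  assumes cont: "continuous_on {0..} y" and start: "y 0 \<in> F"
begin

lemma not_stopped:
  assumes "0 \<le> t" "\<And>u. u \<in> {0..t} \<Longrightarrow> y u \<in> F"
  shows "\<exists>n. \<not> reached n y t"
proof -
  have "continuous_on {0..t} y" using cont by (rule continuous_on_subset) auto
  then obtain n where n: "\<And>r u. r \<in> simple \<Longrightarrow> u \<in> {0..t} \<Longrightarrow> inverse (real (Suc n)) \<le> root_eval r (y u)"
    using inside_F_bound assms by blast
  have "\<not> reached n y t"
  proof
    assume "reached n y t"
    then obtain q :: rat and r where "0 \<le> real_of_rat q" "real_of_rat q < t" "r \<in> simple"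
      "root_eval r (y (real_of_rat q)) < inverse (real (Suc n))"
      unfolding reached_def by blast
    then show False using n[of r "real_of_rat q"] by simp
  qed
  then show ?thesis ..
qed

text \<open>A simple root is at most 0 at \<open>v\<close>, so by continuity it is small at rational
  times just before \<open>v\<close>.\<close>

lemma reached_at_exit:
  assumes "y v \<notin> F" "0 < v"
  shows "\<exists>q::rat. 0 \<le> real_of_rat q \<and> real_of_rat q < v \<and>
     (\<exists>r\<in>simple. root_eval r (y (real_of_rat q)) < inverse (real (Suc n)))"
proof -
  obtain r where r: "r \<in> simple" "root_eval r (y v) \<le> 0"
    using assms(1) by (auto simp: F_eq not_less)
  have "continuous_on {0..} (\<lambda>u. root_eval r (y u))" using cont by (rule continuous_on_root_eval)
  moreover have "v \<in> {0..}" "0 < inverse (real (Suc n))" using assms by auto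
  ultimately obtain d where d: "0 < d"
    "\<And>u. u \<in> {0..} \<Longrightarrow> dist u v < d \<Longrightarrow> dist (root_eval r (y u)) (root_eval r (y v)) < inverse (real (Suc n))"
    unfolding continuous_on_iff by meson
  obtain q :: rat where q: "max 0 (v - d) < real_of_rat q" "real_of_rat q < v"
    using of_rat_dense[of "max 0 (v - d)" v] assms d(1) by auto
  then have "root_eval r (y (real_of_rat q)) < inverse (real (Suc n))"
    using d(2)[of "real_of_rat q"] r(2) by (auto simp: dist_real_def)
  then show ?thesis using q r(1) by (intro exI[of _ q]) auto
qed

lemma stopped_iff:
  assumes "0 \<le> t"
  shows "stopped y t \<longleftrightarrow> (\<exists>u\<in>{0..t}. y u \<notin> F)"
proof
  assume "stopped y t"
  then show "\<exists>u\<in>{0..t}. y u \<notin> F"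
    using not_stopped[OF assms] unfolding stopped_def by blast
next
  assume ex: "\<exists>u\<in>{0..t}. y u \<notin> F"
  define E where "E = {0..t} \<inter> y -` (- F)"
  have "continuous_on {0..t} y" using cont by (rule continuous_on_subset) auto
  then have "closed E"
    unfolding E_def using open_F by (intro continuous_closed_preimage) (auto simp: closed_Compl)
  moreover have "E \<noteq> {}" "bdd_below E"
    using ex by (auto simp: E_def intro: bdd_below.I[of _ 0])
  ultimately have v: "Inf E \<in> E" by (intro closed_contains_Inf)
  define v where "v = Inf E"
  have vE: "0 \<le> v" "v \<le> t" "y v \<notin> F" using v by (auto simp: E_def v_def)
  have before: "y u \<in> F" if "0 \<le> u" "u < v" for u
  proof (rule ccontr)
    assume "y u \<notin> F"
    then have "u \<in> E" using that vE by (auto simp: E_def)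
    then have "v \<le> u" unfolding v_def using \<open>bdd_below E\<close> by (rule cInf_lower)
    then show False using that by simp
  qed
  have "v \<noteq> 0" using start vE by metis
  then have "0 < v" using vE by simp
  have "stopped y v"
    unfolding stopped_def
  proof (intro conjI allI)
    fix n
    obtain q :: rat where q: "0 \<le> real_of_rat q" "real_of_rat q < v"
      "\<exists>r\<in>simple. root_eval r (y (real_of_rat q)) < inverse (real (Suc n))"
      using reached_at_exit[OF vE(3) \<open>0 < v\<close>] by blast
    then show "reached n y v" unfolding reached_def by blast
    \<comment> \<open>Moving strictly past q makes level n reached at the new time, while the path
      is still in \<open>F\<close> up to there, so by compactness some level k is not yet
      reached.\<close>
    obtain r :: rat where r: "real_of_rat q < real_of_rat r" "real_of_rat r < v"
      using of_rat_dense[OF q(2)] by auto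
    then have "reached n y (real_of_rat r)" using q unfolding reached_def by blast
    moreover obtain k where "\<not> reached k y (real_of_rat r)"
    proof -
      have "0 \<le> real_of_rat r" using q(1) r(1) by linarith
      then show thesis using not_stopped[of "real_of_rat r"] before r(2) that by fastforce
    qed
    ultimately show "\<exists>k. \<exists>r::rat. 0 \<le> real_of_rat r \<and> real_of_rat r < v \<and>
        reached n y (real_of_rat r) \<and> \<not> reached k y (real_of_rat r)"
      using r q(1) by (intro exI[of _ k] exI[of _ r]) linarith
  qed
  then show "stopped y t" using vE stopped_mono by blast
qed

lemma less_exit_time_iff: "0 \<le> t \<Longrightarrow> ennreal t < exit_time y \<longleftrightarrow> (\<forall>u\<in>{0..t}. y u \<in> F)"
  using exit_time_le_iff[of t y] stopped_iff[of t] by (auto simp: not_le[symmetric])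

text \<open>At the exit some simple root is at most 0, and as a limit of positive values from the
  left it is at least 0.\<close>

lemma root_zero_at_exit:
  assumes "exit_time y = ennreal v" "0 \<le> v"
  shows "\<exists>r\<in>simple. root_eval r (y v) = 0"
proof -
  have before: "y u \<in> F" if "0 \<le> u" "u < v" for u
    using that less_exit_time_iff[of u] assms by (auto simp: ennreal_less_iff)
  obtain u where u: "u \<in> {0..v}" "y u \<notin> F"
    using less_exit_time_iff[of v] assms by auto
  then have "u = v" using before by fastforce
  then have yv: "y v \<notin> F" using u by simp
  have "v \<noteq> 0" using start yv by metis
  then have "0 < v" using assms by simp
  obtain r where r: "r \<in> simple" "root_eval r (y v) \<le> 0"
    using yv by (auto simp: F_eq not_less)
  have "0 \<le> root_eval r (y v)"
  proof (rule tendsto_lowerbound)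
    have "continuous_on {0..} (\<lambda>u. root_eval r (y u))" using cont by (rule continuous_on_root_eval)
    then have "((\<lambda>u. root_eval r (y u)) \<longlongrightarrow> root_eval r (y v)) (at v within {0..})"
      using assms(2) by (auto simp: continuous_on_def)
    then show "((\<lambda>u. root_eval r (y u)) \<longlongrightarrow> root_eval r (y v)) (at v within {0..<v})"
      by (rule tendsto_within_subset) auto
    show "\<forall>\<^sub>F u in at v within {0..<v}. 0 \<le> root_eval r (y u)"
      unfolding eventually_at_filter
      using before r(1) by (intro always_eventually) (auto simp: F_eq less_imp_le)
    show "at v within {0..<v} \<noteq> bot"
      using \<open>0 < v\<close> by (simp add: at_within_eq_bot_iff islimpt_Ico)
  qed
  then show ?thesis using r by force
qed

lemma exit_time_le_hitting_time:
  assumes "r \<in> pos"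
  shows "exit_time y \<le> hitting_time (\<lambda>s \<gamma>. \<gamma> s) r y"
proof (rule hitting_time_ge)
  fix u :: real assume u: "0 \<le> u" "root_eval r (y u) = 0"
  then have "y u \<notin> F" using pos_on_F[OF assms] by force
  then show "exit_time y \<le> ennreal u"
    using u less_exit_time_iff[of u] by (auto simp: not_le[symmetric])
qed

lemma exit_time_le_set_hitting_time:
  "A \<subseteq> pos \<Longrightarrow> exit_time y \<le> set_hitting_time (\<lambda>s \<gamma>. \<gamma> s) A y"
  unfolding set_hitting_time_def using exit_time_le_hitting_time by (intro INF_greatest) auto

text \<open>Identifies the time built from rational sampling with the time on the left of the
  theorem; a finite exit time is attained on some simple hyperplane.\<close>

lemma set_hitting_time_simple: "set_hitting_time (\<lambda>s \<gamma>. \<gamma> s) simple y = exit_time y"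
proof (rule antisym)
  show "exit_time y \<le> set_hitting_time (\<lambda>s \<gamma>. \<gamma> s) simple y"
    using simple_pos by (rule exit_time_le_set_hitting_time)
  show "set_hitting_time (\<lambda>s \<gamma>. \<gamma> s) simple y \<le> exit_time y"
  proof (cases "exit_time y")
    case (real v)
    then obtain r where r: "r \<in> simple" "root_eval r (y v) = 0" using root_zero_at_exit by blast
    have "set_hitting_time (\<lambda>s \<gamma>. \<gamma> s) simple y \<le> hitting_time (\<lambda>s \<gamma>. \<gamma> s) r y"
      using r(1) by (rule set_hitting_time_le)
    also have "\<dots> \<le> ennreal v" using real r by (intro hitting_time_le) auto
    finally show ?thesis using real by simp
  qed simp
qed

text \<open>The quantifier order in \<open>avoids\<close> is decisive. The margin beyond
  \<open>t\<close> is common to all roots, since a strict bound on an infimum over a possibly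
  infinite \<open>A\<close> needs a uniform gap. The distance from the hyperplane may depend on the
  root: it comes from compactness of the interval from \<open>v\<close> to the end of the
  margin.\<close>

lemma less_set_hitting_time_iff:
  assumes "exit_time y = ennreal v" "0 \<le> v" "v \<le> t" "A \<subseteq> pos"
  shows "ennreal t < set_hitting_time (\<lambda>s \<gamma>. \<gamma> s) A y \<longleftrightarrow> avoids A t v (\<lambda>s. y (v + s))"
proof
  assume "ennreal t < set_hitting_time (\<lambda>s \<gamma>. \<gamma> s) A y"
  then obtain k where "ennreal (t + inverse (real (Suc k))) < set_hitting_time (\<lambda>s \<gamma>. \<gamma> s) A y"
    using ex_ennreal_add_less[of t] assms by auto
  moreover define b where "b = t + inverse (real (Suc k))"
  ultimately have k: "ennreal b < set_hitting_time (\<lambda>s \<gamma>. \<gamma> s) A y" by simp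
  have b: "t < b" by (simp add: b_def)
  have "\<exists>n. \<forall>q::rat. 0 \<le> real_of_rat q \<longrightarrow> v + real_of_rat q \<le> b \<longrightarrow>
     inverse (real (Suc n)) \<le> \<bar>root_eval r (y (v + real_of_rat q))\<bar>" if r: "r \<in> A" for r
  proof -
    have "0 < \<bar>root_eval r (y u)\<bar>" if "u \<in> {v..b}" for u
    proof (rule ccontr)
      assume "\<not> 0 < \<bar>root_eval r (y u)\<bar>"
      then have "hitting_time (\<lambda>s \<gamma>. \<gamma> s) r y \<le> ennreal u"
        using that assms by (intro hitting_time_le) auto
      then have "set_hitting_time (\<lambda>s \<gamma>. \<gamma> s) A y \<le> ennreal u"
        by (rule order_trans[OF set_hitting_time_le[OF r]])
      then have "ennreal b < ennreal u" using k by (rule less_le_trans[rotated])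
      then show False using that b assms by (simp add: ennreal_less_iff)
    qed
    moreover have "continuous_on {v..b} (\<lambda>u. \<bar>root_eval r (y u)\<bar>)"
      using assms(2) by (intro continuous_on_rabs continuous_on_root_eval continuous_on_subset[OF cont]) auto
    ultimately obtain c where c: "c > 0" "\<And>u. u \<in> {v..b} \<Longrightarrow> c \<le> \<bar>root_eval r (y u)\<bar>"
      using continuous_bounded_below[of v b "\<lambda>u. \<bar>root_eval r (y u)\<bar>"] assms b by force
    obtain n where "inverse (real (Suc n)) < c" using reals_Archimedean c(1) by blast
    then have "inverse (real (Suc n)) \<le> \<bar>root_eval r (y (v + real_of_rat q))\<bar>"
      if "0 \<le> real_of_rat q" "v + real_of_rat q \<le> b" for q :: rat
      using c(2)[of "v + real_of_rat q"] that by auto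
    then show ?thesis by blast
  qed
  then show "avoids A t v (\<lambda>s. y (v + s))"
    unfolding avoids_def b_def by blast
next
  assume "avoids A t v (\<lambda>s. y (v + s))"
  then obtain k where k: "\<And>r. r \<in> A \<Longrightarrow> \<exists>n. \<forall>q::rat.
     0 \<le> real_of_rat q \<longrightarrow> v + real_of_rat q \<le> t + inverse (real (Suc k)) \<longrightarrow>
     inverse (real (Suc n)) \<le> \<bar>root_eval r (y (v + real_of_rat q))\<bar>"
    unfolding avoids_def by blast
  define b where "b = t + inverse (real (Suc k))"
  have b: "t < b" by (simp add: b_def)
  have "ennreal b \<le> hitting_time (\<lambda>s \<gamma>. \<gamma> s) r y" if r: "r \<in> A" for r
  proof (rule hitting_time_ge, rule ccontr)
    fix u :: real assume u: "0 \<le> u" "root_eval r (y u) = 0" "\<not> ennreal b \<le> ennreal u"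
    have ub: "u < b" using u by (auto simp: not_le intro: ennreal_leI)
    \<comment> \<open>No positive root vanishes inside \<open>F\<close>, so a zero cannot precede
      the exit and is visible to the shifted path.\<close>
    have "y u \<notin> F" using pos_on_F[of r "y u"] r assms(4) u by force
    then have vu: "v \<le> u"
      using less_exit_time_iff[of u] u assms by (auto simp: ennreal_less_iff not_less)
    obtain n where n: "\<And>q::rat. 0 \<le> real_of_rat q \<Longrightarrow> v + real_of_rat q \<le> b \<Longrightarrow>
       inverse (real (Suc n)) \<le> \<bar>root_eval r (y (v + real_of_rat q))\<bar>"
      using k[OF r] unfolding b_def by blast
    have "continuous_on {0..} (\<lambda>u. root_eval r (y u))" using cont by (rule continuous_on_root_eval)
    moreover have "u \<in> {0..}" "0 < inverse (real (Suc n))" using u by auto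
    ultimately obtain d where d: "0 < d"
      "\<And>w. w \<in> {0..} \<Longrightarrow> dist w u < d \<Longrightarrow> dist (root_eval r (y w)) (root_eval r (y u)) < inverse (real (Suc n))"
      unfolding continuous_on_iff by meson
    \<comment> \<open>Approximating from the right keeps q nonnegative even if the zero occurs
      exactly at the exit; the strict margin leaves room for it.\<close>
    obtain q :: rat where q: "u - v < real_of_rat q" "real_of_rat q < min (b - v) (u + d - v)"
      using of_rat_dense[of "u - v" "min (b - v) (u + d - v)"] ub d(1) by auto
    have "\<bar>root_eval r (y (v + real_of_rat q))\<bar> < inverse (real (Suc n))"
      using d(2)[of "v + real_of_rat q"] q u vu by (auto simp: dist_real_def)
    moreover have "0 \<le> real_of_rat q" "v + real_of_rat q \<le> b" using q vu by linarith+
    ultimately show False using n[of q] by linarith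
  qed
  then have "ennreal b \<le> set_hitting_time (\<lambda>s \<gamma>. \<gamma> s) A y"
    unfolding set_hitting_time_def by (rule INF_greatest)
  moreover have "ennreal t < ennreal b" using b assms by (simp add: ennreal_less_iff)
  ultimately show "ennreal t < set_hitting_time (\<lambda>s \<gamma>. \<gamma> s) A y" by (rule less_le_trans[rotated])
qed

end

lemma root_eval_root_reflection:
  assumes "r \<in> simple"
  shows "root_eval s (root_reflection r z) = root_eval (root_action (root_reflection r) s) z"
proof -
  have "root_reflection r (root_reflection r z) = z"
    using root_reflection_involution[OF assms] by (metis comp_apply id_apply)
  then show ?thesis
    using root_eval_root_action[of "root_reflection r" s "root_reflection r z"]
    by (simp add: assms orthogonal_W root_reflection_in_W)
qed

lemma avoids_reflect:
  assumes "r \<in> simple" "\<And>q. 0 \<le> q \<Longrightarrow> \<gamma>' q = root_reflection r (\<gamma> q)"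
  shows "avoids A t v \<gamma>' \<longleftrightarrow> avoids (reflect r A) t v \<gamma>"
proof -
  have "(\<forall>q::rat. 0 \<le> real_of_rat q \<longrightarrow> v + real_of_rat q \<le> b \<longrightarrow> c \<le> \<bar>root_eval s (\<gamma>' (real_of_rat q))\<bar>) \<longleftrightarrow>
    (\<forall>q::rat. 0 \<le> real_of_rat q \<longrightarrow> v + real_of_rat q \<le> b \<longrightarrow>
       c \<le> \<bar>root_eval (root_action (root_reflection r) s) (\<gamma> (real_of_rat q))\<bar>)" for s b c
    using assms by (simp add: root_eval_root_reflection)
  then show ?thesis unfolding avoids_def by simp
qed

end

section \<open>Reflectable processes after the exit time\<close>

lemma path_component_measurable: "0 \<le> s \<Longrightarrow> (\<lambda>\<gamma>. \<gamma> s) \<in> path_space \<rightarrow>\<^sub>M borel"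
  unfolding path_space_def by (rule measurable_component_singleton) simp

lemma sample_path_measurable:
  "(\<And>s. 0 \<le> s \<Longrightarrow> X s \<in> borel_measurable N) \<Longrightarrow> sample_path X \<in> N \<rightarrow>\<^sub>M path_space"
  unfolding sample_path_def path_space_def by (intro measurable_restrict) auto

text \<open>The random time is approximated by fractions with denominator n + 1. Each approximation
  takes countably many values, so sampling at it is measurable, and continuity of the paths passes
  to the limit.\<close>

lemma continuous_process_at_random_time:
  fixes Y :: "real \<Rightarrow> 'w \<Rightarrow> 'b::metric_space"
  assumes Y: "\<And>s. 0 \<le> s \<Longrightarrow> Y s \<in> borel_measurable N"
    and cont: "\<And>\<omega>. \<omega> \<in> space N \<Longrightarrow> continuous_on {0..} (\<lambda>s. Y s \<omega>)"
    and f: "f \<in> borel_measurable N" and f0: "\<And>\<omega>. \<omega> \<in> space N \<Longrightarrow> 0 \<le> f \<omega>"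
  shows "(\<lambda>\<omega>. Y (f \<omega>) \<omega>) \<in> borel_measurable N"
proof (rule borel_measurable_LIMSEQ_metric)
  define a where "a n \<omega> = real (nat \<lfloor>real (Suc n) * f \<omega>\<rfloor>) / real (Suc n)" for n \<omega>
  show "(\<lambda>\<omega>. Y (a n \<omega>) \<omega>) \<in> borel_measurable N" for n
  proof -
    have "(\<lambda>\<omega>. Y (real (nat \<lfloor>real (Suc n) * f \<omega>\<rfloor>) / real (Suc n)) \<omega>) \<in> borel_measurable N"
    proof (rule measurable_compose_countable[where f = "\<lambda>k \<omega>. Y (real k / real (Suc n)) \<omega>"])
      show "(\<lambda>\<omega>. nat \<lfloor>real (Suc n) * f \<omega>\<rfloor>) \<in> N \<rightarrow>\<^sub>M count_space UNIV"
        using f by measurable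
    qed (intro Y, simp)
    then show ?thesis by (simp add: a_def)
  qed
  fix \<omega> assume \<omega>: "\<omega> \<in> space N"
  have close: "norm (a n \<omega> - f \<omega>) \<le> inverse (real (Suc n))" for n
  proof -
    have "\<bar>real (nat \<lfloor>real (Suc n) * f \<omega>\<rfloor>) - real (Suc n) * f \<omega>\<bar> \<le> 1"
      using f0[OF \<omega>] by (subst of_nat_nat) (simp, linarith)
    then have "\<bar>real (nat \<lfloor>real (Suc n) * f \<omega>\<rfloor>) - real (Suc n) * f \<omega>\<bar> / real (Suc n) \<le> 1 / real (Suc n)"
      by (intro divide_right_mono) auto
    also have "\<bar>real (nat \<lfloor>real (Suc n) * f \<omega>\<rfloor>) - real (Suc n) * f \<omega>\<bar> / real (Suc n)
        = \<bar>(real (nat \<lfloor>real (Suc n) * f \<omega>\<rfloor>) - real (Suc n) * f \<omega>) / real (Suc n)\<bar>"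
      by (simp only: abs_divide abs_of_nat)
    also have "(real (nat \<lfloor>real (Suc n) * f \<omega>\<rfloor>) - real (Suc n) * f \<omega>) / real (Suc n) = a n \<omega> - f \<omega>"
      by (simp add: a_def diff_divide_distrib del: of_nat_Suc)
    finally show ?thesis by (simp add: inverse_eq_divide)
  qed
  have "(\<lambda>n. a n \<omega> - f \<omega>) \<longlonglongrightarrow> 0"
    using close by (intro Lim_null_comparison[OF _ LIMSEQ_inverse_real_of_nat] always_eventually) blast
  then have "(\<lambda>n. a n \<omega>) \<longlonglongrightarrow> f \<omega>" by (rule LIM_zero_cancel)
  then show "(\<lambda>n. Y (a n \<omega>) \<omega>) \<longlonglongrightarrow> Y (f \<omega>) \<omega>"
    using f0[OF \<omega>] by (intro continuous_on_tendsto_compose[OF cont[OF \<omega>]]) (auto simp: a_def)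
qed

lemma avoids_cong:
  "(\<And>s. 0 \<le> s \<Longrightarrow> \<gamma> s = \<gamma>' s) \<Longrightarrow> avoids A t v \<gamma> \<longleftrightarrow> avoids A t v \<gamma>'"
  unfolding avoids_def by (intro arg_cong[where f = Ex] ext ball_cong) auto

text \<open>Joint measurability in starting time and path is required because the starting time will
  be the random exit time. All quantifiers in \<open>avoids\<close> range over countable
  sets.\<close>

lemma avoids_measurable:
  assumes "countable A"
  shows "{z \<in> space (borel \<Otimes>\<^sub>M path_space). fst z \<le> t \<and> avoids A t (fst z) (snd z)}
    \<in> sets (borel \<Otimes>\<^sub>M path_space)"
proof -
  have [measurable]: "(\<lambda>z. snd z s) \<in> borel_measurable (borel \<Otimes>\<^sub>M path_space)" if "0 \<le> s" for s
    using measurable_compose[OF measurable_snd path_component_measurable[OF that]] .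
  have "Measurable.pred (borel \<Otimes>\<^sub>M path_space) (\<lambda>z. \<exists>k. \<forall>r\<in>A. \<exists>n. \<forall>q\<in>{q::rat. 0 \<le> real_of_rat q}.
      fst z + real_of_rat q \<le> t + inverse (real (Suc k)) \<longrightarrow>
      inverse (real (Suc n)) \<le> \<bar>root_eval r (snd z (real_of_rat q))\<bar>)"
    (is "Measurable.pred _ ?Q")
    using assms
    by (intro pred_intros_countable measurable_pred_countable pred_intros_logic) (auto intro!: countableI_type borel_measurable_le)
  moreover have "?Q = (\<lambda>z. avoids A t (fst z) (snd z))"
    by (auto simp: avoids_def fun_eq_iff)
  ultimately have [measurable]: "Measurable.pred (borel \<Otimes>\<^sub>M path_space) (\<lambda>z. avoids A t (fst z) (snd z))"
    by simp
  show ?thesis by measurable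
qed

section \<open>The natural filtration and the exit time as a stopping time\<close>

lemma filtration_natural:
  assumes "\<And>s. 0 \<le> s \<Longrightarrow> X s \<in> borel_measurable M"
  shows "filtration (space M) (natural_filtration M X)"
proof
  show "space (natural_filtration M X i) = space M" for i
    unfolding natural_filtration_def by (rule space_measure_of) auto
  show "sets (natural_filtration M X i) \<subseteq> sets (natural_filtration M X j)" if "i \<le> j" for i j
    unfolding natural_filtration_def
    by (subst (1 2) sets_measure_of) (use that in \<open>auto intro!: sigma_sets_mono' intro: order_trans\<close>)
qed

lemma natural_filtration_sets:
  assumes "\<And>s. 0 \<le> s \<Longrightarrow> X s \<in> borel_measurable M"
  shows "sets (natural_filtration M X u) \<subseteq> sets M"
  unfolding natural_filtration_def
  by (subst sets_measure_of) (use assms in \<open>auto intro!: sets.sigma_sets_subset measurable_sets\<close>)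

lemma natural_filtration_adapted:
  fixes X :: "real \<Rightarrow> 'w \<Rightarrow> real^'n"
  assumes "0 \<le> s" "ennreal s \<le> u"
  shows "X s \<in> borel_measurable (natural_filtration M X u)"
proof (rule measurableI)
  have space: "space (natural_filtration M X u) = space M"
    unfolding natural_filtration_def by (rule space_measure_of) auto
  fix B :: "(real^'n) set" assume "B \<in> sets borel"
  then show "X s -` B \<inter> space (natural_filtration M X u) \<in> sets (natural_filtration M X u)"
    unfolding space unfolding natural_filtration_def
    by (subst sets_measure_of) (use assms in \<open>auto intro!: sigma_sets.Basic\<close>)
qed simp

locale reflectable_process = reflection_setting W pos simple F
  for W :: "(real^'n \<Rightarrow> real^'n) set" and pos simple :: "'n::finite root set" and F +
  fixes M :: "'w measure" and P :: "real^'n \<Rightarrow> 'w measure" and X :: "real \<Rightarrow> 'w \<Rightarrow> real^'n"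
  assumes reflectable: "reflectable W M P X"
begin

lemma prob_space_P: "prob_space (P y)" and sets_P: "sets (P y) = sets M"
  and X_measurable: "0 \<le> s \<Longrightarrow> X s \<in> borel_measurable M"
  and X_start: "AE \<omega> in P y. X 0 \<omega> = y"
  and X_continuous: "AE \<omega> in P y. continuous_on {0..} (\<lambda>s. X s \<omega>)"
  and X_invariant: "w \<in> W \<Longrightarrow> distr (P y) path_space (sample_path (\<lambda>s \<omega>. w (X s \<omega>))) = law P X (w y)"
  and markov: "strong_markov M P X"
  using reflectable by (simp_all add: reflectable_def process_family_def)

lemma space_P: "space (P y) = space M"
  using sets_P by (rule sets_eq_imp_space_eq)

lemma X_measurable_P: "0 \<le> s \<Longrightarrow> X s \<in> borel_measurable (P y)"
  using X_measurable by (simp add: measurable_def space_P sets_P)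

definition T :: "'w \<Rightarrow> ennreal" where
  "T \<omega> = exit_time (\<lambda>s. X s \<omega>)"

lemma stopping_time_T: "stopping_time (natural_filtration M X) T"
proof
  fix u
  interpret filtration "space M" "natural_filtration M X"
    using X_measurable by (rule filtration_natural)
  show "Measurable.pred (natural_filtration M X u) (\<lambda>\<omega>. T \<omega> \<le> u)"
  proof (cases u)
    case (real v)
    have reached: "Measurable.pred (natural_filtration M X u) (\<lambda>\<omega>. reached n (\<lambda>s. X s \<omega>) w)" if "w \<le> v" for n w
    proof -
      have "Measurable.pred (natural_filtration M X u) (\<lambda>\<omega>. \<exists>q\<in>{q::rat. 0 \<le> real_of_rat q \<and> real_of_rat q < w}.
          \<exists>r\<in>simple. root_eval r (X (real_of_rat q) \<omega>) < inverse (real (Suc n)))"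
      proof (intro measurable_pred_countable)
        fix q :: rat and r assume q: "q \<in> {q. 0 \<le> real_of_rat q \<and> real_of_rat q < w}"
        then have "ennreal (real_of_rat q) \<le> u" using that real by (simp add: ennreal_leI)
        then have [measurable]: "X (real_of_rat q) \<in> borel_measurable (natural_filtration M X u)"
          using q by (intro natural_filtration_adapted) auto
        show "Measurable.pred (natural_filtration M X u) (\<lambda>\<omega>. root_eval r (X (real_of_rat q) \<omega>) < inverse (real (Suc n)))"
          by measurable
      qed (auto intro: countable_finite finite_simple)
      moreover have "reached n y w \<longleftrightarrow> (\<exists>q\<in>{q::rat. 0 \<le> real_of_rat q \<and> real_of_rat q < w}.
          \<exists>r\<in>simple. root_eval r (y (real_of_rat q)) < inverse (real (Suc n)))" for y
        unfolding reached_def by blast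
      ultimately show ?thesis by (simp only:)
    qed
    have "Measurable.pred (natural_filtration M X u) (\<lambda>\<omega>. (\<forall>n. reached n (\<lambda>s. X s \<omega>) v) \<and>
      (\<forall>n. \<exists>k. \<exists>r\<in>{r::rat. 0 \<le> real_of_rat r \<and> real_of_rat r < v}.
        reached n (\<lambda>s. X s \<omega>) (real_of_rat r) \<and> \<not> reached k (\<lambda>s. X s \<omega>) (real_of_rat r)))"
      by (intro pred_intros_logic pred_intros_countable measurable_pred_countable reached) auto
    moreover have "stopped y v \<longleftrightarrow> (\<forall>n. reached n y v) \<and>
      (\<forall>n. \<exists>k. \<exists>r\<in>{r::rat. 0 \<le> real_of_rat r \<and> real_of_rat r < v}.
        reached n y (real_of_rat r) \<and> \<not> reached k y (real_of_rat r))" for y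
      unfolding stopped_def by blast
    ultimately show ?thesis
      unfolding real(2) T_def exit_time_le_iff[OF real(1)] by (simp only:)
  qed simp
qed

lemma T_measurable: "T \<in> borel_measurable M"
proof -
  interpret filtration "space M" "natural_filtration M X"
    using X_measurable by (rule filtration_natural)
  show ?thesis
    using natural_filtration_sets[of X M] X_measurable space_F
    by (intro measurable_stopping_time[OF stopping_time_T]) auto
qed

section \<open>Invariance of the law when the process starts on a wall\<close>

definition zero_roots :: "real^'n \<Rightarrow> 'n root set" where
  "zero_roots z = {r\<in>simple. root_eval r z = 0}"

lemma zero_roots_measurable: "{z. zero_roots z = S} \<in> sets borel"
proof (cases "S \<subseteq> simple")
  case True
  then have "{z. zero_roots z = S} = {z \<in> space borel. \<forall>r\<in>simple. (r \<in> S) = (root_eval r z = 0)}"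
    by (auto simp: zero_roots_def)
  also have "\<dots> \<in> sets borel"
    using finite_simple by (intro sets.sets_Collect_finite_All) auto
  finally show ?thesis .
next
  case False
  then have "{z. zero_roots z = S} = {}" by (auto simp: zero_roots_def)
  then show ?thesis by simp
qed

text \<open>The restriction keeps the result in \<open>path_space\<close>, whose elements are
  functions restricted to nonnegative times.\<close>

definition reflect_path :: "'n root \<Rightarrow> (real \<Rightarrow> real^'n) \<Rightarrow> real \<Rightarrow> real^'n" where
  "reflect_path r \<gamma> = (\<lambda>s\<in>{0..}. root_reflection r (\<gamma> s))"

lemma root_reflection_measurable [measurable]: "root_reflection r \<in> borel_measurable borel"
  unfolding root_reflection_def reflection_def
  by (intro borel_measurable_continuous_onI continuous_intros)

lemma reflect_path_measurable: "reflect_path r \<in> path_space \<rightarrow>\<^sub>M path_space"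
proof -
  have "(\<lambda>\<gamma>. \<lambda>s\<in>{0..}. root_reflection r (\<gamma> s)) \<in> path_space \<rightarrow>\<^sub>M (\<Pi>\<^sub>M s\<in>{0..}. borel)"
    by (intro measurable_restrict measurable_compose[OF path_component_measurable]) auto
  then show ?thesis
    by (simp add: reflect_path_def[abs_def] path_space_def)
qed

lemma root_reflection_fixes:
  "root_eval r y = 0 \<Longrightarrow> root_reflection r y = y"
  by (cases r) (simp add: root_eval_def root_reflection_def reflection_def)

lemma prob_space_law: "prob_space (law P X y)"
  unfolding law_def using prob_space_P
  by (intro prob_space.prob_space_distr sample_path_measurable X_measurable_P)

lemma sets_law: "sets (law P X y) = sets path_space"
  by (simp add: law_def)

lemma law_start: "AE \<gamma> in law P X y. \<gamma> 0 = y"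
  unfolding law_def
proof (subst AE_distr_iff)
  show "sample_path X \<in> P y \<rightarrow>\<^sub>M path_space"
    by (intro sample_path_measurable X_measurable_P)
  have "{\<gamma> \<in> space path_space. \<gamma> 0 \<in> {y}} \<in> sets path_space"
    using measurable_sets_Collect[OF path_component_measurable[of 0], of "\<lambda>z. z \<in> {y}"] by simp
  then show "{\<gamma> \<in> space path_space. \<gamma> 0 = y} \<in> sets path_space" by simp
  show "AE \<omega> in P y. sample_path X \<omega> 0 = y"
    using X_start by (simp add: sample_path_def)
qed

text \<open>A point on the hyperplane of \<open>r\<close> is fixed by the reflection, so the
  invariance of the family of laws becomes invariance of the single law started there.\<close>

lemma law_reflect:
  assumes "r \<in> simple" "root_eval r y = 0" "B \<in> sets path_space"
  shows "measure (law P X y) (reflect_path r -` B \<inter> space path_space) = measure (law P X y) B"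
proof -
  have "reflect_path r \<circ> sample_path X = sample_path (\<lambda>s \<omega>. root_reflection r (X s \<omega>))"
    by (auto simp: reflect_path_def sample_path_def fun_eq_iff)
  then have "distr (law P X y) path_space (reflect_path r)
      = distr (P y) path_space (sample_path (\<lambda>s \<omega>. root_reflection r (X s \<omega>)))"
    unfolding law_def
    by (subst distr_distr) (simp_all add: reflect_path_measurable sample_path_measurable X_measurable_P)
  then have "distr (law P X y) path_space (reflect_path r) = law P X y"
    using X_invariant[OF root_reflection_in_W[OF assms(1)]] root_reflection_fixes[OF assms(2)] by simp
  then have "measure (law P X y) B = measure (distr (law P X y) path_space (reflect_path r)) B"
    by simp
  also have "\<dots> = measure (law P X y) (reflect_path r -` B \<inter> space (law P X y))"
    using assms(3) reflect_path_measurable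
    by (intro measure_distr) (simp_all add: law_def)
  finally show ?thesis by (simp add: law_def)
qed

definition exit_event :: "'n root set \<Rightarrow> (real \<Rightarrow> real^'n) set" where
  "exit_event S = {\<gamma> \<in> space path_space. zero_roots (\<gamma> 0) = S}"

lemma exit_event_sets: "exit_event S \<in> sets path_space"
  using measurable_sets_Collect[OF path_component_measurable[of 0], of "\<lambda>z. zero_roots z = S"]
    zero_roots_measurable[of S]
  by (simp add: exit_event_def)

text \<open>The path starts at \<open>y\<close> almost surely, so \<open>exit_event S\<close> has
  probability 0 or 1 under this law.\<close>

lemma law_exit_event:
  assumes "B \<in> sets path_space"
  shows "measure (law P X y) (B \<inter> exit_event S) = (if zero_roots y = S then measure (law P X y) B else 0)"
proof -
  interpret prob_space "law P X y" by (rule prob_space_law)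
  have "measure (law P X y) (B \<inter> exit_event S) = measure (law P X y) (if zero_roots y = S then B else {})"
  proof (rule finite_measure_eq_AE)
    show "AE \<gamma> in law P X y. \<gamma> \<in> B \<inter> exit_event S \<longleftrightarrow> \<gamma> \<in> (if zero_roots y = S then B else {})"
      using law_start
    proof eventually_elim
      case (elim \<gamma>)
      then show ?case using assms sets.sets_into_space by (auto simp: exit_event_def)
    qed
  qed (use assms exit_event_sets in \<open>auto simp: sets_law\<close>)
  then show ?thesis by simp
qed

text \<open>Intersecting with \<open>exit_event S\<close> makes the equality hold for every
  \<open>y\<close>, including those off the hyperplane. This is the form that
  \<open>strong_markov_eq\<close> asks for.\<close>

lemma law_reflect_exit_event:
  assumes "r \<in> S" "S \<subseteq> simple" "B \<in> sets path_space"
  shows "measure (law P X y) (reflect_path r -` B \<inter> space path_space \<inter> exit_event S)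
    = measure (law P X y) (B \<inter> exit_event S)"
proof -
  have "reflect_path r -` B \<inter> space path_space \<in> sets path_space"
    using reflect_path_measurable assms(3) by (rule measurable_sets)
  moreover have "root_eval r y = 0" "r \<in> simple" if "zero_roots y = S"
    using that assms by (auto simp: zero_roots_def)
  ultimately show ?thesis
    using assms(3) law_reflect[of r y B] by (simp add: law_exit_event)
qed

text \<open>Comparing two events instead of computing a conditional probability avoids all questions
  about the measurability of \<open>X T\<close>.\<close>

lemma strong_markov_eq:
  assumes B: "B1 \<in> sets path_space" "B2 \<in> sets path_space"
    and eq: "\<And>y. measure (law P X y) B1 = measure (law P X y) B2"
    and G: "G \<in> sets borel"
    and E: "\<And>B. E B = {\<omega>. T \<omega> < \<infinity> \<and> sample_path (\<lambda>s. X (enn2real (T \<omega>) + s)) \<omega> \<in> B}"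
    and E_sets: "E B1 \<inter> space M \<in> sets (completion (P x))" "E B2 \<inter> space M \<in> sets (completion (P x))"
  shows "measure (completion (P x)) ({\<omega>\<in>space M. enn2real (T \<omega>) \<in> G} \<inter> E B1)
    = measure (completion (P x)) ({\<omega>\<in>space M. enn2real (T \<omega>) \<in> G} \<inter> E B2)"
proof -
  let ?N = "completion (P x)"
  interpret filtration "space M" "natural_filtration M X"
    using X_measurable by (rule filtration_natural)
  let ?S = "pre_sigma T"
  interpret N: prob_space "P x" by (rule prob_space_P)
  have finN: "finite_measure ?N"
    using N.emeasure_space_1 by (intro finite_measureI) (simp add: emeasure_completion)
  have "sets ?S \<subseteq> sets M"
  proof
    fix A assume "A \<in> sets ?S"
    then have "{\<omega>\<in>A. T \<omega> \<le> \<infinity>} \<in> sets (natural_filtration M X \<infinity>)"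
      by (rule sets_pre_sigmaD[OF stopping_time_T])
    then show "A \<in> sets M" using natural_filtration_sets[of X M] X_measurable by auto
  qed
  then have "subalgebra ?N ?S"
    by (auto simp: subalgebra_def space_pre_sigma space_P sets_P)
  then interpret S: finite_measure_subalgebra ?N ?S
    using finN by (simp only: finite_measure_subalgebra_def finite_measure_subalgebra_axioms_def simp_thms)
  \<comment> \<open>The event \<open>H\<close> belongs to the sigma-algebra of the stopping time, so
    conditional expectations may be integrated over it. Letting \<open>G\<close> vary keeps track of
    the exit time itself.\<close>
  define H where "H = {\<omega>\<in>space M. T \<omega> < \<infinity> \<and> enn2real (T \<omega>) \<in> G}"
  have [measurable]: "T \<in> borel_measurable ?S"
    by (rule measurable_stopping_time_pre_sigma[OF stopping_time_T])
  have "{\<omega>\<in>space ?S. T \<omega> < \<infinity> \<and> enn2real (T \<omega>) \<in> G} \<in> sets ?S"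
    using G by measurable
  then have H: "H \<in> sets ?S" by (simp add: H_def space_pre_sigma)
  have HN: "H \<in> sets ?N" using H S.subalg by (auto simp: subalgebra_def)
  have cond: "AE \<omega> in ?N. \<omega> \<in> H \<longrightarrow>
      real_cond_exp ?N ?S (indicator (E B)) \<omega> = measure (law P X (X (enn2real (T \<omega>)) \<omega>)) B"
    if "B \<in> sets path_space" for B
  proof -
    have "AE \<omega> in P x. T \<omega> < \<infinity> \<longrightarrow> real_cond_exp ?N ?S (indicator (E B)) \<omega>
        = measure (law P X (X (enn2real (T \<omega>)) \<omega>)) B"
      using markov stopping_time_T that unfolding strong_markov_def E by blast
    then show ?thesis
      by (intro AE_completion) (auto simp: H_def elim!: eventually_mono)
  qed
  have int: "measure ?N (H \<inter> E B) = (\<integral>\<omega>\<in>H. real_cond_exp ?N ?S (indicator (E B)) \<omega> \<partial>?N)"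
    if "E B \<inter> space M \<in> sets ?N" for B
  proof -
    have "integrable ?N (indicator (E B \<inter> space M) :: 'w \<Rightarrow> real)"
      using that by (simp add: S.emeasure_finite less_top[symmetric])
    then have "integrable ?N (indicator (E B) :: 'w \<Rightarrow> real)"
      by (rule Bochner_Integration.integrable_cong[THEN iffD1, rotated -1])
         (auto simp: indicator_def space_P)
    then have "(\<integral>\<omega>\<in>H. real_cond_exp ?N ?S (indicator (E B)) \<omega> \<partial>?N) = (\<integral>\<omega>\<in>H. indicator (E B) \<omega> \<partial>?N)"
      using H by (intro S.real_cond_exp_intA[symmetric])
    also have "\<dots> = (\<integral>\<omega>. indicator (H \<inter> (E B \<inter> space M)) \<omega> \<partial>?N)"
      unfolding set_lebesgue_integral_def
      by (intro Bochner_Integration.integral_cong) (auto simp: indicator_def H_def)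
    also have "\<dots> = measure ?N (H \<inter> (E B \<inter> space M))"
      by (simp add: space_P Int_assoc)
    also have "H \<inter> (E B \<inter> space M) = H \<inter> E B" by (auto simp: H_def)
    finally show ?thesis by simp
  qed
  have "(\<integral>\<omega>\<in>H. real_cond_exp ?N ?S (indicator (E B1)) \<omega> \<partial>?N)
      = (\<integral>\<omega>\<in>H. real_cond_exp ?N ?S (indicator (E B2)) \<omega> \<partial>?N)"
  proof (rule set_lebesgue_integral_cong_AE)
    show "AE \<omega>\<in>H in ?N. real_cond_exp ?N ?S (indicator (E B1)) \<omega> = real_cond_exp ?N ?S (indicator (E B2)) \<omega>"
      using cond[OF B(1)] cond[OF B(2)] by eventually_elim (simp add: eq)
  qed (use HN in auto)
  then have "measure ?N (H \<inter> E B1) = measure ?N (H \<inter> E B2)"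
    using int E_sets by simp
  moreover have "H \<inter> E B = {\<omega>\<in>space M. enn2real (T \<omega>) \<in> G} \<inter> E B" for B
    by (auto simp: H_def E)
  ultimately show ?thesis by simp
qed

end

section \<open>The continuous modification and its behaviour after the exit\<close>

locale exit_problem = reflectable_process W pos simple F M P X
  for W :: "(real^'n \<Rightarrow> real^'n) set" and pos simple :: "'n::finite root set" and F
    and M :: "'w measure" and P :: "real^'n \<Rightarrow> 'w measure" and X :: "real \<Rightarrow> 'w \<Rightarrow> real^'n" +
  fixes x :: "real^'n" and good :: "'w set"
  assumes x_in_F: "x \<in> F"
    and good_sets: "good \<in> sets M"
    and AE_good: "AE \<omega> in P x. \<omega> \<in> good"
    and good_continuous: "\<And>\<omega>. \<omega> \<in> good \<Longrightarrow> continuous_on {0..} (\<lambda>s. X s \<omega>)"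
    and good_start: "\<And>\<omega>. \<omega> \<in> good \<Longrightarrow> X 0 \<omega> = x"
begin

sublocale N: prob_space "P x" by (rule prob_space_P)

text \<open>Off the full-measure set \<open>good\<close> the path is frozen at \<open>x\<close>, so
  every path is continuous and starts in \<open>F\<close>. The path lemmas then apply everywhere,
  and the events become measurable without completion.\<close>

definition Y :: "real \<Rightarrow> 'w \<Rightarrow> real^'n" where
  "Y s \<omega> = (if \<omega> \<in> good then X s \<omega> else x)"

lemma Y_continuous: "continuous_on {0..} (\<lambda>s. Y s \<omega>)"
  by (cases "\<omega> \<in> good") (simp_all add: Y_def good_continuous)

lemma Y_start: "Y 0 \<omega> \<in> F"
  by (simp add: Y_def good_start x_in_F)

lemma good_sets_P: "good \<in> sets (P x)"
  using good_sets by (simp add: sets_P)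

lemma Y_measurable: "0 \<le> s \<Longrightarrow> Y s \<in> borel_measurable (P x)"
  unfolding Y_def[abs_def] using good_sets_P X_measurable_P by measurable

definition \<tau> :: "'w \<Rightarrow> ennreal" where
  "\<tau> \<omega> = exit_time (\<lambda>s. Y s \<omega>)"

definition V :: "'w \<Rightarrow> real" where
  "V \<omega> = enn2real (\<tau> \<omega>)"

definition shifted :: "'w \<Rightarrow> real \<Rightarrow> real^'n" where
  "shifted = sample_path (\<lambda>s \<omega>. Y (V \<omega> + s) \<omega>)"

lemma \<tau>_good: "\<omega> \<in> good \<Longrightarrow> \<tau> \<omega> = T \<omega>"
  by (simp add: \<tau>_def T_def Y_def)

lemma \<tau>_measurable [measurable]: "\<tau> \<in> borel_measurable (P x)"
proof -
  have T: "T \<in> borel_measurable (P x)"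
    using T_measurable by (simp add: measurable_def space_P sets_P)
  have "\<tau> = (\<lambda>\<omega>. if \<omega> \<in> good then T \<omega> else exit_time (\<lambda>s. x))"
    by (auto simp: \<tau>_good fun_eq_iff) (simp add: \<tau>_def Y_def)
  then show ?thesis using T good_sets_P by simp
qed

lemma V_measurable [measurable]: "V \<in> borel_measurable (P x)"
  unfolding V_def[abs_def] by measurable

lemma V_nonneg: "0 \<le> V \<omega>"
  by (simp add: V_def)

lemma shifted_component_measurable:
  "0 \<le> s \<Longrightarrow> (\<lambda>\<omega>. Y (V \<omega> + s) \<omega>) \<in> borel_measurable (P x)"
  by (rule continuous_process_at_random_time[where Y = Y and f = "\<lambda>\<omega>. V \<omega> + s", OF Y_measurable Y_continuous])
     (simp_all add: V_nonneg)

lemma shifted_measurable [measurable]: "shifted \<in> P x \<rightarrow>\<^sub>M path_space"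
  unfolding shifted_def by (intro sample_path_measurable shifted_component_measurable)

lemma shifted_apply: "0 \<le> s \<Longrightarrow> shifted \<omega> s = Y (V \<omega> + s) \<omega>"
  by (simp add: shifted_def sample_path_def)

definition exit_face :: "'n root set \<Rightarrow> 'w set" where
  "exit_face S = {\<omega>\<in>space M. \<tau> \<omega> < \<infinity> \<and> zero_roots (Y (V \<omega>) \<omega>) = S}"

lemma exit_face_eq: "exit_face S = {\<omega>\<in>space (P x). \<tau> \<omega> < \<infinity> \<and> shifted \<omega> \<in> exit_event S}"
proof -
  have "shifted \<omega> \<in> space path_space" if "\<omega> \<in> space (P x)" for \<omega>
    using shifted_measurable that by (rule measurable_space)
  then show ?thesis
    using shifted_apply[of 0] by (auto simp: exit_face_def exit_event_def space_P)
qed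

lemma exit_face_sets: "exit_face S \<in> sets (P x)"
proof -
  note exit_event_sets[measurable]
  show ?thesis unfolding exit_face_eq by measurable
qed

text \<open>The strong Markov comparison, for events prescribing the exit time and the later path
  separately. The sets \<open>E\<close> use the original process and live in the completion; the
  sets \<open>E'\<close> use the modification and are measurable for \<open>P x\<close> itself. They
  agree on \<open>good\<close>.\<close>

lemma exit_face_reflect_rectangle:
  assumes "r \<in> S" "S \<subseteq> simple" "G \<in> sets borel" "B \<in> sets path_space"
  shows "measure (P x) {\<omega>\<in>exit_face S. V \<omega> \<in> G \<and> reflect_path r (shifted \<omega>) \<in> B}
    = measure (P x) {\<omega>\<in>exit_face S. V \<omega> \<in> G \<and> shifted \<omega> \<in> B}"
proof -
  define E where "E B = {\<omega>. T \<omega> < \<infinity> \<and> sample_path (\<lambda>s. X (enn2real (T \<omega>) + s)) \<omega> \<in> B}" for B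
  define E' where "E' B = {\<omega>\<in>space (P x). \<tau> \<omega> < \<infinity> \<and> shifted \<omega> \<in> B}" for B
  have E'_sets: "E' B \<in> sets (P x)" if [measurable]: "B \<in> sets path_space" for B
    unfolding E'_def by measurable
  have good_eq: "\<omega> \<in> E B \<longleftrightarrow> \<omega> \<in> E' B" if "\<omega> \<in> good" "\<omega> \<in> space (P x)" for \<omega> B
    using that by (simp add: E_def E'_def shifted_def sample_path_def V_def \<tau>_good Y_def)
  have AE: "AE \<omega> in completion (P x). \<omega> \<in> good \<and> \<omega> \<in> space (P x)"
    using AE_good by (intro AE_completion) auto
  have E_sets: "E B \<inter> space M \<in> sets (completion (P x))" if "B \<in> sets path_space" for B
  proof (rule completion.in_sets_AE)
    show "AE \<omega> in completion (P x). \<omega> \<in> E' B \<longleftrightarrow> \<omega> \<in> E B \<inter> space M"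
      using AE by eventually_elim (auto simp: good_eq space_P)
  qed (use E'_sets that in \<open>auto simp: space_P\<close>)
  have G_sets: "{\<omega>\<in>space (P x). V \<omega> \<in> G} \<in> sets (P x)"
    using assms(3) by measurable
  have meas: "measure (completion (P x)) ({\<omega>\<in>space M. enn2real (T \<omega>) \<in> G} \<inter> E B)
      = measure (P x) ({\<omega>\<in>space (P x). V \<omega> \<in> G} \<inter> E' B)" if "B \<in> sets path_space" for B
  proof -
    have set: "{\<omega>\<in>space (P x). V \<omega> \<in> G} \<inter> E' B \<in> sets (P x)"
      using G_sets E'_sets that by blast
    have AE': "AE \<omega> in completion (P x). \<omega> \<in> {\<omega>\<in>space (P x). V \<omega> \<in> G} \<inter> E' B \<longleftrightarrow>
        \<omega> \<in> {\<omega>\<in>space M. enn2real (T \<omega>) \<in> G} \<inter> E B"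
      using AE by eventually_elim (auto simp: good_eq space_P V_def \<tau>_good)
    have "{\<omega>\<in>space M. enn2real (T \<omega>) \<in> G} \<inter> E B \<in> sets (completion (P x))"
      using set by (intro completion.in_sets_AE[OF AE']) (auto simp: space_P)
    then have "measure (completion (P x)) ({\<omega>\<in>space M. enn2real (T \<omega>) \<in> G} \<inter> E B)
      = measure (completion (P x)) ({\<omega>\<in>space (P x). V \<omega> \<in> G} \<inter> E' B)"
      using AE' set by (intro measure_eq_AE) (auto elim!: eventually_mono)
    then show ?thesis using set by simp
  qed
  let ?B1 = "reflect_path r -` B \<inter> space path_space \<inter> exit_event S" and ?B2 = "B \<inter> exit_event S"
  have B: "?B1 \<in> sets path_space" "?B2 \<in> sets path_space"
    using assms exit_event_sets measurable_sets[OF reflect_path_measurable] by auto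
  have "measure (P x) ({\<omega>\<in>space (P x). V \<omega> \<in> G} \<inter> E' ?B1)
      = measure (P x) ({\<omega>\<in>space (P x). V \<omega> \<in> G} \<inter> E' ?B2)"
    using strong_markov_eq[OF B law_reflect_exit_event[OF assms(1,2,4)] assms(3) E_def E_sets[OF B(1)] E_sets[OF B(2)]]
    by (simp only: meas B)
  moreover have "{\<omega>\<in>space (P x). V \<omega> \<in> G} \<inter> E' ?B1
      = {\<omega>\<in>exit_face S. V \<omega> \<in> G \<and> reflect_path r (shifted \<omega>) \<in> B}"
    by (auto simp: E'_def exit_face_eq exit_event_def)
  moreover have "{\<omega>\<in>space (P x). V \<omega> \<in> G} \<inter> E' ?B2 = {\<omega>\<in>exit_face S. V \<omega> \<in> G \<and> shifted \<omega> \<in> B}"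
    by (auto simp: E'_def exit_face_eq)
  ultimately show ?thesis by simp
qed

text \<open>Rectangles are stable under intersection and generate the product sigma-algebra.
  Restricting \<open>P x\<close> to the face by a density yields two finite measures that agree on
  them, hence everywhere.\<close>

lemma exit_face_reflect:
  assumes r: "r \<in> S" "S \<subseteq> simple" and D: "D \<in> sets (borel \<Otimes>\<^sub>M path_space)"
  shows "measure (P x) {\<omega>\<in>exit_face S. (V \<omega>, reflect_path r (shifted \<omega>)) \<in> D}
    = measure (P x) {\<omega>\<in>exit_face S. (V \<omega>, shifted \<omega>) \<in> D}"
proof -
  let ?Q = "borel \<Otimes>\<^sub>M path_space :: (real \<times> (real \<Rightarrow> real^'n)) measure"
  let ?N = "density (P x) (indicator (exit_face S))"
  let ?Z = "\<lambda>\<omega>. (V \<omega>, shifted \<omega>)" and ?Z' = "\<lambda>\<omega>. (V \<omega>, reflect_path r (shifted \<omega>))"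
  have Z: "?Z \<in> P x \<rightarrow>\<^sub>M ?Q" "?Z' \<in> P x \<rightarrow>\<^sub>M ?Q"
    by (intro measurable_Pair V_measurable shifted_measurable
        measurable_compose[OF shifted_measurable reflect_path_measurable])+
  have em: "emeasure (distr ?N ?Q z) D = emeasure (P x) {\<omega>\<in>exit_face S. z \<omega> \<in> D}"
    if "z \<in> P x \<rightarrow>\<^sub>M ?Q" "D \<in> sets ?Q" for z D
  proof -
    have "emeasure (distr ?N ?Q z) D = emeasure ?N (z -` D \<inter> space (P x))"
      using that by (subst emeasure_distr) auto
    also have "\<dots> = emeasure (P x) (exit_face S \<inter> (z -` D \<inter> space (P x)))"
      using that exit_face_sets by (intro emeasure_restricted) auto
    also have "exit_face S \<inter> (z -` D \<inter> space (P x)) = {\<omega>\<in>exit_face S. z \<omega> \<in> D}"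
      by (auto simp: exit_face_eq)
    finally show ?thesis .
  qed
  have "distr ?N ?Q ?Z' = distr ?N ?Q ?Z"
  proof (rule measure_eqI_generator_eq[OF Int_stable_pair_measure_generator[of borel path_space],
        where A = "\<lambda>_. space ?Q" and \<Omega> = "space borel \<times> space path_space"])
    show "{a \<times> b |a b. a \<in> sets borel \<and> b \<in> sets path_space}
        \<subseteq> Pow (space borel \<times> space path_space :: (real \<times> (real \<Rightarrow> real^'n)) set)"
      using sets.sets_into_space[of _ path_space] by auto
    fix D assume "D \<in> {a \<times> b |a b. a \<in> sets (borel :: real measure) \<and> b \<in> sets (path_space :: (real \<Rightarrow> real^'n) measure)}"
    then obtain G B where D: "D = G \<times> B" and GB: "G \<in> sets borel" "B \<in> sets path_space" by blast
    then have "D \<in> sets ?Q" by simp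
    then show "emeasure (distr ?N ?Q ?Z') D = emeasure (distr ?N ?Q ?Z) D"
      using exit_face_reflect_rectangle[OF r GB] by (simp add: em Z N.emeasure_eq_measure D)
  next
    show "emeasure (distr ?N ?Q ?Z') (space ?Q) \<noteq> \<infinity>" for i :: nat
      using Z by (simp add: em N.emeasure_eq_measure)
    have "space borel \<times> space path_space \<in> {a \<times> b |a b. a \<in> sets (borel :: real measure) \<and> b \<in> sets (path_space :: (real \<Rightarrow> real^'n) measure)}"
      using sets.top by blast
    then show "range (\<lambda>_::nat. space ?Q) \<subseteq> {a \<times> b |a b. a \<in> sets borel \<and> b \<in> sets path_space}"
      by (simp add: space_pair_measure image_subset_iff)
  qed (simp_all add: sets_pair_measure space_pair_measure)
  then have "emeasure (distr ?N ?Q ?Z') D = emeasure (distr ?N ?Q ?Z) D" by simp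
  then show ?thesis
    using D Z by (simp add: em measure_def)
qed

text \<open>After the exit the hyperplanes must be avoided for the time \<open>t - V\<close>, which is random. This is
  why the invariance is needed for the joint law of \<open>V\<close> and the shifted path.\<close>

definition surviving_after_exit :: "real \<Rightarrow> 'n root set \<Rightarrow> 'n root set \<Rightarrow> 'w set" where
  "surviving_after_exit t S A = {\<omega>\<in>exit_face S. V \<omega> \<le> t \<and> avoids A t (V \<omega>) (shifted \<omega>)}"

definition avoiding :: "real \<Rightarrow> 'n root set \<Rightarrow> (real \<times> (real \<Rightarrow> real^'n)) set" where
  "avoiding t A = {z \<in> space (borel \<Otimes>\<^sub>M path_space). fst z \<le> t \<and> avoids A t (fst z) (snd z)}"

lemma avoiding_sets: "A \<subseteq> pos \<Longrightarrow> avoiding t A \<in> sets (borel \<Otimes>\<^sub>M path_space)"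
  unfolding avoiding_def using countable_pos countable_subset by (intro avoids_measurable) blast

lemma surviving_after_exit_eq:
  "surviving_after_exit t S A = {\<omega>\<in>exit_face S. (V \<omega>, shifted \<omega>) \<in> avoiding t A}"
  using measurable_space[OF shifted_measurable]
  by (auto simp: surviving_after_exit_def avoiding_def space_pair_measure exit_face_eq)

lemma surviving_after_exit_sets:
  assumes "A \<subseteq> pos"
  shows "surviving_after_exit t S A \<in> sets (P x)"
proof -
  have "(\<lambda>\<omega>. (V \<omega>, shifted \<omega>)) -` avoiding t A \<inter> space (P x) \<in> sets (P x)"
    using avoiding_sets[OF assms]
    by (intro measurable_sets[OF measurable_Pair[OF V_measurable shifted_measurable]])
  moreover have "surviving_after_exit t S A
      = exit_face S \<inter> ((\<lambda>\<omega>. (V \<omega>, shifted \<omega>)) -` avoiding t A \<inter> space (P x))"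
    by (auto simp: surviving_after_exit_eq exit_face_eq)
  ultimately show ?thesis using exit_face_sets by auto
qed

lemma surviving_after_exit_empty:
  assumes "r \<in> S" "r \<in> A"
  shows "surviving_after_exit t S A = {}"
proof -
  have "\<not> avoids A t (V \<omega>) (shifted \<omega>)" if "\<omega> \<in> exit_face S" "V \<omega> \<le> t" for \<omega>
  proof (rule not_avoids[OF assms(2) _ that(2)])
    show "root_eval r (shifted \<omega> 0) = 0"
      using that assms(1) by (auto simp: exit_face_def zero_roots_def shifted_apply)
  qed
  then show ?thesis by (auto simp: surviving_after_exit_def)
qed

text \<open>Reflecting the shifted path has the same effect as reflecting \<open>A\<close>, so
  invariance of the joint law at the exit applies.\<close>

lemma surviving_after_exit_reflect:
  assumes "r \<in> S" "S \<subseteq> simple" "A \<subseteq> pos"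
  shows "measure (P x) (surviving_after_exit t S (reflect r A)) = measure (P x) (surviving_after_exit t S A)"
proof -
  have "surviving_after_exit t S (reflect r A)
      = {\<omega>\<in>exit_face S. (V \<omega>, reflect_path r (shifted \<omega>)) \<in> avoiding t A}"
  proof -
    have "avoids A t v (reflect_path r \<gamma>) \<longleftrightarrow> avoids (reflect r A) t v \<gamma>" for v \<gamma>
      using assms by (intro avoids_reflect) (auto simp: reflect_path_def)
    moreover have "reflect_path r (shifted \<omega>) \<in> space path_space" if "\<omega> \<in> exit_face S" for \<omega>
      using that measurable_space[OF measurable_compose[OF shifted_measurable reflect_path_measurable]]
      by (auto simp: exit_face_eq)
    ultimately show ?thesis
      by (auto simp: surviving_after_exit_def avoiding_def space_pair_measure)
  qed
  then show ?thesis
    using exit_face_reflect[OF assms(1,2) avoiding_sets[OF assms(3)]]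
    by (simp add: surviving_after_exit_eq)
qed

section \<open>Survival probabilities split according to the exit face\<close>

lemma survival_event_eq:
  assumes "0 \<le> t" "A \<subseteq> pos"
  shows "{\<omega>\<in>space (P x). ennreal t < set_hitting_time Y A \<omega>} =
    {\<omega>\<in>space (P x). ennreal t < \<tau> \<omega>} \<union> (\<Union>S\<in>Pow simple - {{}}. surviving_after_exit t S A)"
proof -
  have "ennreal t < set_hitting_time Y A \<omega> \<longleftrightarrow>
      ennreal t < \<tau> \<omega> \<or> (\<exists>S\<in>Pow simple - {{}}. \<omega> \<in> surviving_after_exit t S A)"
    if \<omega>: "\<omega> \<in> space (P x)" for \<omega>
  proof -
    let ?y = "\<lambda>s. Y s \<omega>"
    have hit: "set_hitting_time Y A \<omega> = set_hitting_time (\<lambda>s \<gamma>. \<gamma> s) A ?y"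
      by (simp add: set_hitting_time_def hitting_time_def)
    show ?thesis
    proof (cases "ennreal t < \<tau> \<omega>")
      case True
      then have "ennreal t < set_hitting_time Y A \<omega>"
        using exit_time_le_set_hitting_time[OF Y_continuous Y_start assms(2)]
        unfolding hit \<tau>_def by (rule less_le_trans)
      then show ?thesis using True by simp
    next
      case False
      then have le: "\<tau> \<omega> \<le> ennreal t" by simp
      then have fin: "\<tau> \<omega> < \<infinity>" by (simp add: le_less_trans)
      then have \<tau>V: "\<tau> \<omega> = ennreal (V \<omega>)" by (simp add: V_def)
      then have Vt: "V \<omega> \<le> t" using le assms(1) by (simp add: ennreal_le_iff)
      \<comment> \<open>An exit at a finite time happens on a simple hyperplane, so the nonempty
        sets \<open>S\<close> account for every such path.\<close>
      have "zero_roots (Y (V \<omega>) \<omega>) \<noteq> {}"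
        using root_zero_at_exit[OF Y_continuous Y_start \<tau>V[unfolded \<tau>_def] V_nonneg]
        by (auto simp: zero_roots_def)
      moreover have "zero_roots (Y (V \<omega>) \<omega>) \<subseteq> simple" by (auto simp: zero_roots_def)
      ultimately have "(\<exists>S\<in>Pow simple - {{}}. \<omega> \<in> surviving_after_exit t S A) \<longleftrightarrow>
          avoids A t (V \<omega>) (shifted \<omega>)"
        using \<omega> fin Vt by (auto simp: surviving_after_exit_def exit_face_def space_P)
      also have "\<dots> \<longleftrightarrow> avoids A t (V \<omega>) (\<lambda>s. Y (V \<omega> + s) \<omega>)"
        by (intro avoids_cong) (simp add: shifted_apply)
      also have "\<dots> \<longleftrightarrow> ennreal t < set_hitting_time Y A \<omega>"
        using less_set_hitting_time_iff[OF Y_continuous Y_start \<tau>V[unfolded \<tau>_def] V_nonneg Vt assms(2)]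
        by (simp add: hit)
      finally show ?thesis using False by simp
    qed
  qed
  moreover have "surviving_after_exit t S A \<subseteq> space (P x)" for S
    by (auto simp: surviving_after_exit_def exit_face_def space_P)
  ultimately show ?thesis by blast
qed

lemma survival_event_sets:
  assumes "0 \<le> t" "A \<subseteq> pos"
  shows "{\<omega>\<in>space (P x). ennreal t < set_hitting_time Y A \<omega>} \<in> sets (P x)"
proof -
  have "(\<Union>S\<in>Pow simple - {{}}. surviving_after_exit t S A) \<in> sets (P x)"
    using finite_simple surviving_after_exit_sets[OF assms(2)] by (intro sets.finite_UN) auto
  moreover have "{\<omega>\<in>space (P x). ennreal t < \<tau> \<omega>} \<in> sets (P x)" by measurable
  ultimately show ?thesis unfolding survival_event_eq[OF assms] by blast
qed

lemma survival_prob_eq_measure: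
  assumes "0 \<le> t" "A \<subseteq> pos"
  shows "survival_prob (P x) X A t = measure (P x) {\<omega>\<in>space (P x). ennreal t < set_hitting_time Y A \<omega>}"
proof -
  let ?E = "{\<omega>\<in>space (P x). ennreal t < set_hitting_time X A \<omega>}"
    and ?E' = "{\<omega>\<in>space (P x). ennreal t < set_hitting_time Y A \<omega>}"
  have AE: "AE \<omega> in completion (P x). \<omega> \<in> ?E' \<longleftrightarrow> \<omega> \<in> ?E"
  proof (rule AE_completion, use AE_good in eventually_elim)
    fix \<omega> assume "\<omega> \<in> good"
    then have "set_hitting_time Y A \<omega> = set_hitting_time X A \<omega>"
      by (simp add: set_hitting_time_def hitting_time_def Y_def)
    then show "\<omega> \<in> ?E' \<longleftrightarrow> \<omega> \<in> ?E" by simp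
  qed
  have E': "?E' \<in> sets (P x)" using survival_event_sets[OF assms] .
  then have "?E \<in> sets (completion (P x))"
    by (intro completion.in_sets_AE[OF AE]) auto
  then have "measure (completion (P x)) ?E = measure (completion (P x)) ?E'"
    using AE E' by (intro measure_eq_AE) (auto elim!: eventually_mono)
  then show ?thesis using E' by (simp add: survival_prob_def)
qed

lemma survival_prob_eq_sum:
  assumes "0 \<le> t" "A \<subseteq> pos"
  shows "survival_prob (P x) X A t = measure (P x) {\<omega>\<in>space (P x). ennreal t < \<tau> \<omega>}
    + (\<Sum>S\<in>Pow simple - {{}}. measure (P x) (surviving_after_exit t S A))"
proof -
  let ?E = "{\<omega>\<in>space (P x). ennreal t < \<tau> \<omega>}" and ?U = "\<Union>S\<in>Pow simple - {{}}. surviving_after_exit t S A"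
  have fin: "finite (Pow simple - {{}})" using finite_simple by simp
  have sets: "surviving_after_exit t S A \<in> sets (P x)" for S
    using assms(2) by (rule surviving_after_exit_sets)
  have "?E \<in> sets (P x)" by measurable
  moreover have "?U \<in> sets (P x)" using fin sets by (intro sets.finite_UN) auto
  \<comment> \<open>On \<open>?U\<close> the exit time is finite and its real value \<open>V\<close>
    is at most \<open>t\<close>, which contradicts \<open>?E\<close>.\<close>
  moreover have "?E \<inter> ?U = {}"
    by (auto simp: surviving_after_exit_def exit_face_def V_def)
       (metis ennreal_enn2real ennreal_le_iff2 enn2real_nonneg leD infinity_ennreal_def ennreal_leI)
  ultimately have "measure (P x) (?E \<union> ?U) = measure (P x) ?E + measure (P x) ?U"
    by (rule N.finite_measure_Union)
  moreover have "measure (P x) ?U = (\<Sum>S\<in>Pow simple - {{}}. measure (P x) (surviving_after_exit t S A))"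
    using fin sets
    by (intro N.finite_measure_finite_Union)
       (auto simp: disjoint_family_on_def surviving_after_exit_def exit_face_def)
  ultimately show ?thesis
    using survival_event_eq[OF assms] by (simp add: survival_prob_eq_measure assms)
qed

lemma survival_prob_simple:
  assumes "0 \<le> t"
  shows "survival_prob (P x) X simple t = measure (P x) {\<omega>\<in>space (P x). ennreal t < \<tau> \<omega>}"
proof -
  have "set_hitting_time Y simple \<omega> = set_hitting_time (\<lambda>s \<gamma>. \<gamma> s) simple (\<lambda>s. Y s \<omega>)" for \<omega>
    by (simp add: set_hitting_time_def hitting_time_def)
  then have "set_hitting_time Y simple \<omega> = \<tau> \<omega>" for \<omega>
    using set_hitting_time_simple[OF Y_continuous Y_start] by (simp add: \<tau>_def)
  then show ?thesis using survival_prob_eq_measure[OF assms simple_pos] by simp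
qed

lemma reflection_principle:
  assumes "consistent W pos simple I" "I \<subseteq> pos" "0 \<le> t"
  shows "survival_prob (P x) X simple t =
    (\<Sum>A\<in>positive_orbit W pos I. orbit_sign W pos I A * survival_prob (P x) X A t)"
proof -
  interpret consistent_set W pos simple F I
    by standard (use assms in auto)
  let ?m = "measure (P x) {\<omega>\<in>space (P x). ennreal t < \<tau> \<omega>}"
  let ?q = "\<lambda>S A. measure (P x) (surviving_after_exit t S A)"
  have "(\<Sum>A\<in>orbit. \<epsilon> A * survival_prob (P x) X A t)
      = (\<Sum>A\<in>orbit. \<epsilon> A * ?m + (\<Sum>S\<in>Pow simple - {{}}. \<epsilon> A * ?q S A))"
    using assms(3) orbit_pos
    by (intro sum.cong) (simp_all add: survival_prob_eq_sum distrib_left sum_distrib_left)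
  also have "\<dots> = (\<Sum>A\<in>orbit. \<epsilon> A) * ?m + (\<Sum>A\<in>orbit. \<Sum>S\<in>Pow simple - {{}}. \<epsilon> A * ?q S A)"
    by (simp add: sum.distrib sum_distrib_right)
  also have "(\<Sum>A\<in>orbit. \<Sum>S\<in>Pow simple - {{}}. \<epsilon> A * ?q S A)
      = (\<Sum>S\<in>Pow simple - {{}}. \<Sum>A\<in>orbit. \<epsilon> A * ?q S A)"
    by (rule sum.swap)
  also have "\<dots> = 0"
  proof (rule sum.neutral, rule ballI)
    fix S assume S: "S \<in> Pow simple - {{}}"
    \<comment> \<open>Any element of \<open>S\<close> works: each of its roots vanishes at the exit
      point.\<close>
    then obtain r where r: "r \<in> S" "S \<subseteq> simple" by blast
    show "(\<Sum>A\<in>orbit. \<epsilon> A * ?q S A) = 0"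
      using r orbit_pos
      by (intro sum_orbit_eq_0[of r]) (auto simp: surviving_after_exit_empty surviving_after_exit_reflect)
  qed
  finally show ?thesis by (simp add: sum_orbit_sign survival_prob_simple assms)
qed

end

lemma (in reflectable_process) survival_prob_eq_signed_sum:
  assumes "consistent W pos simple I" "I \<subseteq> pos" "x \<in> F" "0 \<le> t"
  shows "survival_prob (P x) X simple t =
    (\<Sum>A\<in>positive_orbit W pos I. orbit_sign W pos I A * survival_prob (P x) X A t)"
proof -
  have "AE \<omega> in P x. continuous_on {0..} (\<lambda>s. X s \<omega>) \<and> X 0 \<omega> = x"
    using X_continuous X_start by eventually_elim simp
  \<comment> \<open>The set of bad paths need not be measurable; a measurable null set covering it
    is removed instead, which makes \<open>good\<close> an event.\<close>
  then obtain N where N: "{\<omega>\<in>space (P x). \<not> (continuous_on {0..} (\<lambda>s. X s \<omega>) \<and> X 0 \<omega> = x)} \<subseteq> N"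
      "emeasure (P x) N = 0" "N \<in> sets (P x)"
    by (rule AE_E)
  interpret exit_problem W pos simple F M P X x "space M - N"
  proof
    show "space M - N \<in> sets M" using N(3) by (auto simp: sets_P)
    have "AE \<omega> in P x. \<omega> \<notin> N" using N by (intro AE_not_in) auto
    then show "AE \<omega> in P x. \<omega> \<in> space M - N"
      by (rule AE_mp) (simp flip: space_P[of x])
  qed (use N(1) assms(3) in \<open>auto simp: space_P\<close>)
  show ?thesis using assms by (intro reflection_principle)
qed

theorem theorem7:
  fixes \<Phi> \<Delta> :: "(real^'n) set" and \<theta> :: "real^'n"
    and W :: "(real^'n \<Rightarrow> real^'n) set" and \<phi> pos simple :: "'n root set" and F :: "(real^'n) set"
    and I :: "'n root set"
    and M :: "'w measure" and P :: "real^'n \<Rightarrow> 'w measure" and X :: "real \<Rightarrow> 'w \<Rightarrow> real^'n"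
    and x :: "real^'n" and t :: real
  assumes "root_system \<Phi>" and "crystallographic \<Phi>" and "irreducible_roots \<Phi>"
    and "simple_system \<Phi> \<Delta>" and "highest_root \<Phi> \<Delta> \<theta>"
    and "(W, \<phi>, pos, simple, F) = finite_data \<Phi> \<Delta> \<or>
         (W, \<phi>, pos, simple, F) = affine_data \<Phi> \<Delta> \<theta>"
    and "I \<subseteq> pos" and "consistent W pos simple I"
    and "reflectable W M P X"
    and "x \<in> F" and "0 \<le> t"
  shows "survival_prob (P x) X simple t =
    (\<Sum>A\<in>positive_orbit W pos I. orbit_sign W pos I A * survival_prob (P x) X A t)"
proof -
  interpret highest_root_system \<Phi> \<Delta> \<theta>
    by standard (use assms in auto)
  have "reflection_setting W pos simple F"
    using assms(6) finite_setting affine_setting by (auto simp: finite_data_def affine_data_def)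
  then interpret reflectable_process W pos simple F M P X
    using assms(9) by (intro reflectable_process.intro reflectable_process_axioms.intro)
  show ?thesis using assms by (intro survival_prob_eq_signed_sum)
qed

end
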